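(* Fix an arbitrary admissible couple $(z,z')$ of parameters and let the parameter $w$ equal $0$ while the parameter $w'$ is positive and goes to $+\infty$. Assume that the positive integer $N$ varies together with $w'$ in such a way that $N\sim rw'$ with an arbitrary fixed $r>0$. Then the corresponding zw-measures ${}^{\mathbb{GT}}M^{(z,z',0,w')}_N$ (which for $w'$ large are concentrated on nonnegative signatures and are therefore viewed as measures on the set $\mathbb Y$ of Young diagrams) weakly converge to the z-measure ${}^{\mathbb{YB}}M^{(-z,-z')}_r$ on $\mathbb Y$.
   Context: **Notation.** $\mathbb Y$ is the (countable, discrete) set of all Young diagrams $\mu$, including $\varnothing$; $|\mu|$ is the number of boxes and $\dim\mu$ the number of standard Young tableaux of shape $\mu$ ($\dim\varnothing=1$). For $z\in\mathbb C$, $(z)_\mu=\prod_{(i,j)\in\mu}(z+j-i)$, product over the boxes of $\mu$ ($i$ row number, $j$ column number). A couple $(z,z')\in\mathbb C^2$ is *admissible* if $z\ne0$, $z'\ne0$ and $(z)_\mu(z')_\mu\ge0$ for all $\mu\in\mathbb Y$. This property is invariant under $(z,z')\mapsto(-z,-z')$. **z-measures.** For admissible $(z,z')$ and $r>0$, the z-measure on $\mathbb Y$ is $${}^{\mathbb{YB}}M^{(z,z')}_r(\mu)=(1+r)^{-zz'}(z)_\mu(z')_\mu\Bigl(\frac r{1+r}\Bigr)^{|\mu|}\Bigl(\frac{\dim\mu}{|\mu|!}\Bigr)^2.$$ **zw-measures.** $\mathbb{GT}_N$ is the set of signatures of length $N$, i.e. integer vectors $\mu=(\mu_1\ge\dots\ge\mu_N)$,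 and $\mathrm{Dim}[\mu,N]=\prod_{1\le i<j\le N}\frac{\mu_i-\mu_j-i+j}{j-i}$. The zw-measure on $\mathbb{GT}_N$ with parameters $(z,z',w,w')$ is $${}^{\mathbb{GT}}M^{(z,z',w,w')}_N(\mu)=C_N\cdot\Pi_N(\mu)\cdot(\mathrm{Dim}[\mu,N])^2,$$ $$C_N=\prod_{i=1}^N\frac{\Gamma(z+w+i)\Gamma(z+w'+i)\Gamma(z'+w+i)\Gamma(z'+w'+i)\Gamma(i)}{\Gamma(z+z'+w+w'+i)},$$ $$\Pi_N(\mu)=\prod_{i=1}^N\frac1{\Gamma(z-\mu_i+i)\Gamma(z'-\mu_i+i)\Gamma(w+N+1+\mu_i-i)\Gamma(w'+N+1+\mu_i-i)},$$ where singularities of $C_N$ are cancelled by zeros of $\Pi_N(\mu)$. For $w=0$ and $w'$ real, positive and large enough, after these cancellations the measure takes the following form, which is the definition used for every admissible couple $(z,z')$: it is zero on signatures $\mu$ with $\mu_N<0$, and for $\mu_N\ge0$ $${}^{\mathbb{GT}}M^{(z,z',0,w')}_N(\mu)=\left(\prod_{i=1}^N\frac{\Gamma(z+w'+i)\Gamma(z'+w'+i)}{\Gamma(z+z'+w'+i)\Gamma(w'+i)}\right)\widetilde\Pi_N(\mu)\,(\mathrm{Dim}[\mu,N])^2,$$ $$\widetilde\Pi_N(\mu)=\prod_{i=1}^N\frac{\Gamma(z+i)\Gamma(z'+i)}{\Gamma(z-\mu_i+i)\Gamma(z'-\mu_i+i)}\cdot\prod_{i=1}^N\frac{\Gamma(N+1-i)\,\Gamma(w'+N+1-i)}{\Gamma(N+1+\mu_i-i)\,\Gamma(w'+N+1+\mu_i-i)},$$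 where, for $\mu_i\ge0$, the ratio $\Gamma(z+i)/\Gamma(z-\mu_i+i)$ is understood as the polynomial $\prod_{k=1}^{\mu_i}(z+i-k)$ (and similarly for $z'$). A nonnegative signature ($\mu_N\ge0$) of length $N$ is identified with the Young diagram with rows $\mu_1,\dots,\mu_N$, so such signatures form a subset of $\mathbb Y$. *)

theory Defs
  imports "HOL-Analysis.Analysis" "HOL-Library.Landau_Symbols"
begin

text \<open>
  A Young diagram is represented by its finite set of boxes \<open>(i, j)\<close>, with row number \<open>i\<close> and
  column number \<open>j\<close> both counted from 1.
\<close>

definition young_diagrams :: "(nat \<times> nat) set set" where
  "young_diagrams = {\<mu>. finite \<mu> \<and>
     (\<forall>(i, j)\<in>\<mu>. 1 \<le> i \<and> 1 \<le> j \<and> {1..i} \<times> {1..j} \<subseteq> \<mu>)}"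

definition standard_tableaux :: "(nat \<times> nat) set \<Rightarrow> (nat \<times> nat \<Rightarrow> nat) set" where
  "standard_tableaux \<mu> = {T \<in> \<mu> \<rightarrow>\<^sub>E {1..card \<mu>}. bij_betw T \<mu> {1..card \<mu>} \<and>
     (\<forall>i j. (i, j) \<in> \<mu> \<and> (i, Suc j) \<in> \<mu> \<longrightarrow> T (i, j) < T (i, Suc j)) \<and>
     (\<forall>i j. (i, j) \<in> \<mu> \<and> (Suc i, j) \<in> \<mu> \<longrightarrow> T (i, j) < T (Suc i, j))}"

definition dim_diagram :: "(nat \<times> nat) set \<Rightarrow> nat" where
  "dim_diagram \<mu> = card (standard_tableaux \<mu>)"

definition diagram_pochhammer :: "complex \<Rightarrow> (nat \<times> nat) set \<Rightarrow> complex" where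
  "diagram_pochhammer z \<mu> = (\<Prod>(i, j)\<in>\<mu>. z + of_nat j - of_nat i)"

definition admissible :: "complex \<Rightarrow> complex \<Rightarrow> bool" where
  "admissible z z' \<longleftrightarrow> z \<noteq> 0 \<and> z' \<noteq> 0 \<and>
     (\<forall>\<mu>\<in>young_diagrams. diagram_pochhammer z \<mu> * diagram_pochhammer z' \<mu> \<in> \<real>\<^sub>\<ge>\<^sub>0)"

definition z_mass :: "complex \<Rightarrow> complex \<Rightarrow> real \<Rightarrow> (nat \<times> nat) set \<Rightarrow> complex" where
  "z_mass z z' r \<mu> = of_real (1 + r) powr (- (z * z')) *
     diagram_pochhammer z \<mu> * diagram_pochhammer z' \<mu> *
     of_real ((r / (1 + r)) ^ card \<mu> * (real (dim_diagram \<mu>) / fact (card \<mu>))\<^sup>2)"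

text \<open>
  The point masses are given by complex expressions whose values are nonnegative real numbers
  (lemmas \<open>z_mass_nonneg\<close> and \<open>zw_mass_nonneg\<close> below), so that taking the real part
  and applying \<open>ennreal\<close> loses nothing.
\<close>

definition z_measure :: "complex \<Rightarrow> complex \<Rightarrow> real \<Rightarrow> (nat \<times> nat) set measure" where
  "z_measure z z' r =
     density (count_space young_diagrams) (\<lambda>\<mu>. ennreal (Re (z_mass z z' r \<mu>)))"

definition signatures :: "nat \<Rightarrow> (nat \<Rightarrow> int) set" where
  "signatures N = {\<mu> \<in> {1..N} \<rightarrow>\<^sub>E UNIV. \<forall>i\<in>{1..N}. \<forall>j\<in>{1..N}. i \<le> j \<longrightarrow> \<mu> j \<le> \<mu> i}"

definition Dim_signature :: "nat \<Rightarrow> (nat \<Rightarrow> int) \<Rightarrow> real" where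
  "Dim_signature N \<mu> = (\<Prod>(i, j) | 1 \<le> i \<and> i < j \<and> j \<le> N.
     (real_of_int (\<mu> i) - real_of_int (\<mu> j) - real i + real j) / (real j - real i))"

text \<open>
  For \<open>m \<ge> 0\<close> this is the ratio \<open>Gamma (z + i) / Gamma (z - m + i)\<close>, read as a polynomial in \<open>z\<close>.
\<close>

definition gamma_ratio :: "complex \<Rightarrow> nat \<Rightarrow> int \<Rightarrow> complex" where
  "gamma_ratio z i m = (\<Prod>k = 1..nat m. z + of_nat i - of_nat k)"

text \<open>
  The zw-measure with \<open>w = 0\<close>, after the cancellation of the singularities of the normalising
  constant with the zeros of the remaining factor.
\<close>

definition zw_prefactor :: "complex \<Rightarrow> complex \<Rightarrow> real \<Rightarrow> nat \<Rightarrow> complex" where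
  "zw_prefactor z z' w' N = (\<Prod>i = 1..N.
     (Gamma (z + of_real w' + of_nat i) * Gamma (z' + of_real w' + of_nat i)) /
     (Gamma (z + z' + of_real w' + of_nat i) * Gamma (of_real w' + of_nat i)))"

definition zw_Pi :: "complex \<Rightarrow> complex \<Rightarrow> real \<Rightarrow> nat \<Rightarrow> (nat \<Rightarrow> int) \<Rightarrow> complex" where
  "zw_Pi z z' w' N \<mu> =
     (\<Prod>i = 1..N. gamma_ratio z i (\<mu> i) * gamma_ratio z' i (\<mu> i)) *
     of_real (\<Prod>i = 1..N.
       (Gamma (real N + 1 - real i) * Gamma (w' + real N + 1 - real i)) /
       (Gamma (real N + 1 + real_of_int (\<mu> i) - real i) *
        Gamma (w' + real N + 1 + real_of_int (\<mu> i) - real i)))"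

definition zw_mass :: "complex \<Rightarrow> complex \<Rightarrow> real \<Rightarrow> nat \<Rightarrow> (nat \<Rightarrow> int) \<Rightarrow> complex" where
  "zw_mass z z' w' N \<mu> =
     (if \<mu> N < 0 then 0
      else zw_prefactor z z' w' N * zw_Pi z z' w' N \<mu> * of_real ((Dim_signature N \<mu>)\<^sup>2))"

definition zw_measure :: "complex \<Rightarrow> complex \<Rightarrow> real \<Rightarrow> nat \<Rightarrow> (nat \<Rightarrow> int) measure" where
  "zw_measure z z' w' N =
     density (count_space (signatures N)) (\<lambda>\<mu>. ennreal (Re (zw_mass z z' w' N \<mu>)))"

text \<open>
  On nonnegative signatures this is the usual identification with Young diagrams. The values at
  the other signatures, which have mass zero, play no role.
\<close>

definition diagram_of_signature :: "nat \<Rightarrow> (nat \<Rightarrow> int) \<Rightarrow> (nat \<times> nat) set" where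
  "diagram_of_signature N \<mu> = (SIGMA i:{1..N}. {1..nat (\<mu> i)})"

definition zw_measure_young :: "complex \<Rightarrow> complex \<Rightarrow> real \<Rightarrow> nat \<Rightarrow> (nat \<times> nat) set measure" where
  "zw_measure_young z z' w' N =
     distr (zw_measure z z' w' N) (count_space young_diagrams) (diagram_of_signature N)"

text \<open>
  Finiteness is part of the notion because \<open>integral\<^sup>L\<close> of a non-integrable function is \<open>0\<close>.
\<close>

definition weak_convergence ::
  "'a topology \<Rightarrow> ('i \<Rightarrow> 'a measure) \<Rightarrow> 'a measure \<Rightarrow> 'i filter \<Rightarrow> bool" where
  "weak_convergence X M L F \<longleftrightarrow>
     (\<forall>\<^sub>F t in F. finite_measure (M t)) \<and> finite_measure L \<and>
     (\<forall>f :: 'a \<Rightarrow> real. continuous_map X euclideanreal f \<and> bounded (f ` topspace X) \<longrightarrow>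
        ((\<lambda>t. integral\<^sup>L (M t) f) \<longlongrightarrow> integral\<^sup>L L f) F)"


lemma finite_young_diagram: "\<mu> \<in> young_diagrams \<Longrightarrow> finite \<mu>"
  by (simp add: young_diagrams_def)

lemma swap_young_diagram:
  assumes "\<mu> \<in> young_diagrams"
  shows "prod.swap ` \<mu> \<in> young_diagrams"
proof -
  have "finite (prod.swap ` \<mu>)"
    using assms by (simp add: young_diagrams_def)
  moreover have "1 \<le> i \<and> 1 \<le> j \<and> {1..i} \<times> {1..j} \<subseteq> prod.swap ` \<mu>"
    if "(i, j) \<in> prod.swap ` \<mu>" for i j
  proof -
    have "(j, i) \<in> \<mu>"
      using that by auto
    then have *: "1 \<le> j" "1 \<le> i" "{1..j} \<times> {1..i} \<subseteq> \<mu>"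
      using assms by (auto simp: young_diagrams_def)
    have "{1..i} \<times> {1..j} = prod.swap ` ({1..j} \<times> {1..i})"
      by (simp add: product_swap)
    then show ?thesis
      using * by (metis image_mono)
  qed
  ultimately show ?thesis
    unfolding young_diagrams_def by blast
qed

lemma diagram_pochhammer_uminus:
  "diagram_pochhammer (- z) \<mu> = (- 1) ^ card \<mu> * diagram_pochhammer z (prod.swap ` \<mu>)"
proof -
  have "diagram_pochhammer z (prod.swap ` \<mu>) = (\<Prod>b\<in>\<mu>. z + of_nat (fst b) - of_nat (snd b))"
    unfolding diagram_pochhammer_def
    by (subst prod.reindex) (auto intro!: inj_onI prod.cong)
  moreover have "diagram_pochhammer (- z) \<mu> =
      (\<Prod>b\<in>\<mu>. (- 1) * (z + of_nat (fst b) - of_nat (snd b)))"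
    unfolding diagram_pochhammer_def by (intro prod.cong) auto
  ultimately show ?thesis
    by (simp only: prod.distrib prod_constant)
qed

lemma diagram_pochhammer_uminus_mult:
  "diagram_pochhammer (- z) \<mu> * diagram_pochhammer (- z') \<mu> =
   diagram_pochhammer z (prod.swap ` \<mu>) * diagram_pochhammer z' (prod.swap ` \<mu>)"
proof -
  have "(- 1 :: complex) ^ card \<mu> * (- 1) ^ card \<mu> = 1"
    by (simp flip: power_mult_distrib)
  then show ?thesis
    unfolding diagram_pochhammer_uminus by (simp add: algebra_simps)
qed

lemma admissible_uminus: "admissible z z' \<Longrightarrow> admissible (- z) (- z')"
  by (simp add: admissible_def diagram_pochhammer_uminus_mult swap_young_diagram)

lemma admissible_cases:
  assumes "admissible z z'"
  shows "z * z' \<in> \<real>" and "z' = cnj z \<or> z \<in> \<real> \<and> z' \<in> \<real>"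
proof -
  have "{(1, 1)} \<in> young_diagrams" "{(1, 1), (1, 2)} \<in> young_diagrams"
    by (auto simp: young_diagrams_def numeral_2_eq_2 le_Suc_eq)
  then have "diagram_pochhammer z {(1, 1)} * diagram_pochhammer z' {(1, 1)} \<in> \<real>\<^sub>\<ge>\<^sub>0"
    "diagram_pochhammer z {(1, 1), (1, 2)} * diagram_pochhammer z' {(1, 1), (1, 2)} \<in> \<real>\<^sub>\<ge>\<^sub>0"
    using assms unfolding admissible_def by blast+
  then have 1: "z * z' \<in> \<real>" and 2: "(z * z') * ((z + 1) * (z' + 1)) \<in> \<real>"
    by (auto simp: diagram_pochhammer_def mult_ac add.commute dest!: nonneg_Reals_Real)
  have nz: "z \<noteq> 0" "z' \<noteq> 0"
    using assms by (auto simp: admissible_def)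
  have "(z * z') * ((z + 1) * (z' + 1)) / (z * z') \<in> \<real>"
    using 1 2 by (rule Reals_divide[rotated])
  then have "(z + 1) * (z' + 1) \<in> \<real>"
    using nz by simp
  then have "(z + 1) * (z' + 1) - z * z' - 1 \<in> \<real>"
    using 1 by (intro Reals_diff Reals_1)
  then have sum: "z + z' \<in> \<real>"
    by (simp add: algebra_simps)
  show "z * z' \<in> \<real>" by (fact 1)
  have im: "Im z' = - Im z" and "Re z * Im z' + Im z * Re z' = 0"
    using sum 1 by (auto simp: complex_is_Real_iff)
  then have "Im z * (Re z' - Re z) = 0"
    by (simp add: algebra_simps)
  then show "z' = cnj z \<or> z \<in> \<real> \<and> z' \<in> \<real>"
    using im by (auto simp: complex_is_Real_iff complex_eq_iff)
qed

lemma z_mass_nonneg: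
  assumes "admissible z z'" "r > 0" "\<mu> \<in> young_diagrams"
  shows "z_mass z z' r \<mu> \<in> \<real>\<^sub>\<ge>\<^sub>0"
proof -
  obtain c where c: "z * z' = of_real c"
    using admissible_cases(1)[OF assms(1)] by (auto elim: Reals_cases)
  have "of_real (1 + r) powr (- (z * z')) = complex_of_real ((1 + r) powr (- c))"
    using powr_of_real[of "1 + r" "- c"] assms(2) by (simp add: c)
  then have "of_real (1 + r) powr (- (z * z')) \<in> (\<real>\<^sub>\<ge>\<^sub>0 :: complex set)"
    by (simp only: nonneg_Reals_of_real_iff powr_ge_zero)
  moreover have "diagram_pochhammer z \<mu> * diagram_pochhammer z' \<mu> \<in> \<real>\<^sub>\<ge>\<^sub>0"
    using assms by (simp add: admissible_def)
  moreover have "of_real ((r / (1 + r)) ^ card \<mu> * (real (dim_diagram \<mu>) / fact (card \<mu>))\<^sup>2)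
      \<in> (\<real>\<^sub>\<ge>\<^sub>0 :: complex set)"
    unfolding nonneg_Reals_of_real_iff using assms(2) by simp
  ultimately have "of_real (1 + r) powr (- (z * z')) *
      (diagram_pochhammer z \<mu> * diagram_pochhammer z' \<mu>) *
      of_real ((r / (1 + r)) ^ card \<mu> * (real (dim_diagram \<mu>) / fact (card \<mu>))\<^sup>2) \<in> \<real>\<^sub>\<ge>\<^sub>0"
    by (rule nonneg_Reals_mult_I[OF nonneg_Reals_mult_I])
  then show ?thesis
    by (simp only: z_mass_def mult.assoc)
qed

lemma diagram_of_signature_young:
  assumes "\<mu> \<in> signatures N"
  shows "diagram_of_signature N \<mu> \<in> young_diagrams"
proof -
  have "(i', j') \<in> diagram_of_signature N \<mu>"
    if "(i, j) \<in> diagram_of_signature N \<mu>" "i' \<in> {1..i}" "j' \<in> {1..j}" for i j i' j'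
  proof -
    have "\<mu> i \<le> \<mu> i'"
      using that assms by (auto simp: signatures_def diagram_of_signature_def)
    then show ?thesis
      using that by (auto simp: diagram_of_signature_def)
  qed
  then show ?thesis
    by (auto simp: young_diagrams_def diagram_of_signature_def)
qed

lemma inj_on_diagram_of_signature:
  "inj_on (diagram_of_signature N) {\<mu> \<in> signatures N. \<forall>i\<in>{1..N}. 0 \<le> \<mu> i}"
proof (rule inj_onI, clarsimp)
  fix \<mu> \<nu>
  assume *: "\<mu> \<in> signatures N" "\<nu> \<in> signatures N" "\<forall>i\<in>{Suc 0..N}. 0 \<le> \<mu> i"
    "\<forall>i\<in>{Suc 0..N}. 0 \<le> \<nu> i" "diagram_of_signature N \<mu> = diagram_of_signature N \<nu>"
  show "\<mu> = \<nu>"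
  proof (rule PiE_ext)
    show "\<mu> \<in> {1..N} \<rightarrow>\<^sub>E UNIV" "\<nu> \<in> {1..N} \<rightarrow>\<^sub>E UNIV"
      using * by (auto simp: signatures_def)
    fix i assume i: "i \<in> {1..N}"
    have "{1..nat (\<mu> i)} = diagram_of_signature N \<mu> `` {i}"
      "{1..nat (\<nu> i)} = diagram_of_signature N \<nu> `` {i}"
      using i by (auto simp: diagram_of_signature_def)
    then have "card {1..nat (\<mu> i)} = card {1..nat (\<nu> i)}"
      using * by simp
    then have "nat (\<mu> i) = nat (\<nu> i)"
      by simp
    moreover have "0 \<le> \<mu> i" "0 \<le> \<nu> i"
      using *(3,4) i by auto
    ultimately show "\<mu> i = \<nu> i"
      by simp
  qed
qed

lemma prod_gamma_ratio:
  "(\<Prod>i = 1..N. gamma_ratio z i (\<mu> i)) =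
   diagram_pochhammer z (prod.swap ` diagram_of_signature N \<mu>)"
proof -
  have "diagram_pochhammer z (prod.swap ` diagram_of_signature N \<mu>) =
      (\<Prod>(i, k)\<in>diagram_of_signature N \<mu>. z + of_nat i - of_nat k)"
    unfolding diagram_pochhammer_def
    by (subst prod.reindex) (auto intro!: inj_onI prod.cong)
  then show ?thesis
    unfolding gamma_ratio_def diagram_of_signature_def by (simp add: prod.Sigma)
qed

lemma zw_prefactor_nonneg:
  assumes "admissible z z'" "norm z + norm z' \<le> w'"
  shows "zw_prefactor z z' w' N \<in> \<real>\<^sub>\<ge>\<^sub>0"
proof -
  have pos: "Gamma (z + of_real w' + of_nat i) * Gamma (z' + of_real w' + of_nat i) /
    (Gamma (z + z' + of_real w' + of_nat i) * Gamma (of_real w' + of_nat i)) \<in> \<real>\<^sub>\<ge>\<^sub>0"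
    if i: "i \<ge> 1" for i :: nat
  proof -
    have G: "Gamma u \<in> (\<real>\<^sub>\<ge>\<^sub>0 :: complex set)" if u: "u \<in> \<real>" "Re u > 0" for u
    proof -
      have "Gamma u = complex_of_real (Gamma (Re u))"
        using u(1) by (metis Gamma_complex_of_real of_real_Re)
      then show ?thesis
        using Gamma_real_pos[OF u(2)] by simp
    qed
    have w: "\<bar>Re z\<bar> + \<bar>Re z'\<bar> \<le> w'" "w' \<ge> 0" "real i \<ge> 1"
      using assms(2) abs_Re_le_cmod[of z] abs_Re_le_cmod[of z'] i by auto
    have sum: "z + z' \<in> \<real>"
      using admissible_cases(2)[OF assms(1)] by (auto simp: complex_is_Real_iff)
    have "Gamma (z + z' + of_real w' + of_nat i) \<in> \<real>\<^sub>\<ge>\<^sub>0"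
      using sum w by (intro G Reals_add[OF Reals_add[OF sum]]) auto
    moreover have "Gamma (of_real w' + of_nat i) \<in> (\<real>\<^sub>\<ge>\<^sub>0 :: complex set)"
      using w by (intro G Reals_add) auto
    moreover have "Gamma (z + of_real w' + of_nat i) * Gamma (z' + of_real w' + of_nat i) \<in> \<real>\<^sub>\<ge>\<^sub>0"
      using admissible_cases(2)[OF assms(1)]
    proof
      assume "z' = cnj z"
      then have "Gamma (z' + of_real w' + of_nat i) = cnj (Gamma (z + of_real w' + of_nat i))"
        by (simp add: cnj_Gamma)
      then show ?thesis
        by (simp only: complex_mult_cnj nonneg_Reals_of_real_iff) simp
    next
      assume "z \<in> \<real> \<and> z' \<in> \<real>"
      then show ?thesis
        using w by (intro nonneg_Reals_mult_I G Reals_add) auto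
    qed
    ultimately show ?thesis
      by (blast intro: nonneg_Reals_divide_I nonneg_Reals_mult_I)
  qed
  have prod: "(\<Prod>i\<in>I. f i) \<in> \<real>\<^sub>\<ge>\<^sub>0" if "\<And>i. i \<in> I \<Longrightarrow> f i \<in> \<real>\<^sub>\<ge>\<^sub>0" for f :: "nat \<Rightarrow> complex" and I
    using that by (induction I rule: infinite_finite_induct) auto
  show ?thesis
    unfolding zw_prefactor_def by (rule prod, rule pos) simp
qed

lemma zw_mass_nonneg:
  assumes "admissible z z'" "norm z + norm z' \<le> w'" "\<mu> \<in> signatures N"
  shows "zw_mass z z' w' N \<mu> \<in> \<real>\<^sub>\<ge>\<^sub>0"
proof (cases "\<mu> N < 0")
  case False
  have mono: "0 \<le> \<mu> i" if "i \<in> {1..N}" for i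
  proof -
    have "\<mu> N \<le> \<mu> i"
      using assms(3) that by (auto simp: signatures_def)
    then show ?thesis using False by simp
  qed
  have "diagram_pochhammer z (prod.swap ` diagram_of_signature N \<mu>) *
      diagram_pochhammer z' (prod.swap ` diagram_of_signature N \<mu>) \<in> \<real>\<^sub>\<ge>\<^sub>0"
    using assms(1) swap_young_diagram[OF diagram_of_signature_young[OF assms(3)]]
    by (simp add: admissible_def)
  then have "(\<Prod>i = 1..N. gamma_ratio z i (\<mu> i) * gamma_ratio z' i (\<mu> i)) \<in> \<real>\<^sub>\<ge>\<^sub>0"
    by (simp only: prod.distrib prod_gamma_ratio)
  moreover have "0 \<le> (\<Prod>i = 1..N.
       (Gamma (real N + 1 - real i) * Gamma (w' + real N + 1 - real i)) /
       (Gamma (real N + 1 + real_of_int (\<mu> i) - real i) *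
        Gamma (w' + real N + 1 + real_of_int (\<mu> i) - real i)))"
  proof (intro prod_nonneg ballI divide_nonneg_nonneg mult_nonneg_nonneg)
    fix i assume i: "i \<in> {1..N}"
    have "w' \<ge> 0" "real i \<le> real N" "real_of_int (\<mu> i) \<ge> 0"
      using order_trans[OF add_nonneg_nonneg[OF norm_ge_zero norm_ge_zero] assms(2)] i mono[OF i]
      by auto
    then have "0 < real N + 1 - real i" "0 < w' + real N + 1 - real i"
      "0 < real N + 1 + real_of_int (\<mu> i) - real i"
      "0 < w' + real N + 1 + real_of_int (\<mu> i) - real i"
      by linarith+
    then show "0 \<le> Gamma (real N + 1 - real i)" "0 \<le> Gamma (w' + real N + 1 - real i)"
      "0 \<le> Gamma (real N + 1 + real_of_int (\<mu> i) - real i)"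
      "0 \<le> Gamma (w' + real N + 1 + real_of_int (\<mu> i) - real i)"
      by (auto intro: less_imp_le Gamma_real_pos)
  qed
  ultimately have "zw_Pi z z' w' N \<mu> \<in> \<real>\<^sub>\<ge>\<^sub>0"
    unfolding zw_Pi_def by (intro nonneg_Reals_mult_I) (simp_all only: nonneg_Reals_of_real_iff)
  moreover have "of_real ((Dim_signature N \<mu>)\<^sup>2) \<in> (\<real>\<^sub>\<ge>\<^sub>0 :: complex set)"
    unfolding nonneg_Reals_of_real_iff by simp
  ultimately show ?thesis
    using False zw_prefactor_nonneg[OF assms(1,2)]
    unfolding zw_mass_def by (simp only: if_False) (intro nonneg_Reals_mult_I)
qed (simp add: zw_mass_def)

end

theory Submission
  imports Defs "HOL-Real_Asymp.Real_Asymp"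
begin

text \<open>
  Both measures have explicit point masses, so weak convergence on the discrete set of Young
  diagrams is a statement about sums over diagrams: it follows from pointwise convergence of the
  masses together with one summable function dominating all of them.

  Pointwise convergence. Let \<open>\<nu>\<close> be the diagram of a nonnegative signature \<open>\<mu>\<close>, and let \<open>(x)\<close> stand
  for the product of \<open>x + c\<close> over the contents \<open>c = j - i\<close> of the boxes \<open>(i, j)\<close> of \<open>\<nu>\<close>. The products of
  Gamma quotients in the zw-mass are \<open>1 / (N)\<close> and \<open>1 / (N + w')\<close>, and the dimension of the signature
  is \<open>(N) * dim \<nu> / fact (card \<nu>)\<close> (lemma \<open>dim_diagram_eq_Dim_signature\<close>, proved from the branching
  rule and a partial fraction identity). Hence the zw-mass at \<open>\<nu>\<close> is the normalising constant times
  \<open>(-z) (-z') (dim \<nu> / fact (card \<nu>))\<^sup>2\<close> times \<open>(N) / (N + w')\<close>. For fixed \<open>\<nu>\<close> the last quotient tends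
  to the power \<open>card \<nu>\<close> of \<open>r / (1 + r)\<close>, because \<open>N\<close> grows like \<open>r w'\<close>. The normalising constant tends
  to the power \<open>- z z'\<close> of \<open>1 + r\<close> (lemma \<open>zw_prefactor_tendsto\<close>): its factor of index \<open>i\<close> is
  \<open>1 - z z' / (w' + i)\<close> up to a relatively small error, and the sum of \<open>1 / (w' + i)\<close> over \<open>i \<le> N\<close> tends
  to \<open>ln (1 + r)\<close>.

  Domination. Comparing the number of standard tableaux with the contents gives
  \<open>dim \<nu> / fact (card \<nu>) \<le> 1 / (\<Prod> max 1 \<bar>c\<bar>)\<close> (lemma \<open>dim_diagram_content_bound\<close>), so that every zw-mass
  with large \<open>w'\<close> is bounded by a constant times a product over the boxes of a factor that depends
  on \<open>\<bar>c\<bar>\<close> only. In Frobenius coordinates, which determine the diagram, such a product splits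
  into one factor for each arm and one for each leg on the diagonal. Its sum over all diagrams is
  therefore at most a product of two expressions of the form \<open>\<Prod> (1 + \<theta> x)\<close>, which are finite if
  \<open>\<theta>\<close> is summable (lemma \<open>content_product_summable\<close>). Summability of \<open>\<theta>\<close> holds because the factor
  \<open>(N + c) / (N + w' + c)\<close> makes \<open>\<theta>\<close> decay like a negative power that improves with \<open>w'\<close>.
\<close>

section \<open>A partial fraction identity for shifted Vandermonde products\<close>

text \<open>
  For distinct \<open>x\<close>, this is the factor by which the Vandermonde product of \<open>x\<close> over \<open>I\<close> changes
  when \<open>x k\<close> is lowered by 1.
\<close>

definition shift_quotient :: "('i \<Rightarrow> real) \<Rightarrow> 'i set \<Rightarrow> 'i \<Rightarrow> real" where
  "shift_quotient x I k = (\<Prod>j\<in>I - {k}. 1 - 1 / (x k - x j))"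

lemma shift_quotient_insert:
  assumes "finite I" "b \<notin> I" "k \<in> I"
  shows "shift_quotient x (insert b I) k = shift_quotient x I k * (1 - 1 / (x k - x b))"
proof -
  have "insert b I - {k} = insert b (I - {k})"
    using assms by auto
  then show ?thesis
    using assms by (simp add: shift_quotient_def)
qed

lemma shift_quotient_insert_same:
  assumes "b \<notin> I"
  shows "shift_quotient x (insert b I) b = (\<Prod>j\<in>I. 1 - 1 / (x b - x j))"
  using assms by (simp add: shift_quotient_def insert_Diff_if)

text \<open>
  The left side is a rational function of \<open>t\<close> with simple poles at the \<open>x k\<close> and value 1 at
  infinity. The next two lemmas are the first two coefficients of its expansion at infinity.
\<close>

lemma shift_quotient_partial_fractions:
  assumes "finite I" "inj_on x I" "t \<notin> x ` I"
  shows "(\<Prod>j\<in>I. 1 - 1 / (t - x j)) = 1 - (\<Sum>k\<in>I. shift_quotient x I k / (t - x k))"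
  using assms
proof (induction I arbitrary: t rule: finite_induct)
  case (insert b I)
  let ?R = "shift_quotient x I"
  have xb: "x b \<notin> x ` I" and inj: "inj_on x I"
    using insert.prems insert.hyps by auto
  have tb: "t \<noteq> x b" and tI: "t \<notin> x ` I"
    using insert.prems by auto
  note IHt = insert.IH[OF inj tI] and IHb = insert.IH[OF inj xb]
  have "shift_quotient x (insert b I) k / (t - x k) =
      ?R k / (t - x k) + (?R k / (x b - x k) - ?R k / (t - x k)) / (t - x b)" if "k \<in> I" for k
  proof -
    have "x k \<noteq> x b" "t \<noteq> x k"
      using xb tI that by (metis image_eqI)+
    then have ne: "x b - x k \<noteq> 0" "t - x k \<noteq> 0" "t - x b \<noteq> 0" "x k - x b \<noteq> 0"
      using tb by auto
    show ?thesis
      unfolding shift_quotient_insert[OF insert.hyps(1,2) that]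
      using ne by (simp add: divide_simps) (simp add: algebra_simps)
  qed
  then have "(\<Sum>k\<in>I. shift_quotient x (insert b I) k / (t - x k)) =
      (\<Sum>k\<in>I. ?R k / (t - x k) + (?R k / (x b - x k) - ?R k / (t - x k)) / (t - x b))"
    by (rule sum.cong[OF refl])
  also have "\<dots> = (\<Sum>k\<in>I. ?R k / (t - x k)) +
      ((\<Sum>k\<in>I. ?R k / (x b - x k)) - (\<Sum>k\<in>I. ?R k / (t - x k))) / (t - x b)"
    by (simp only: sum.distrib sum_divide_distrib[symmetric] sum_subtractf)
  finally have S: "(\<Sum>k\<in>I. shift_quotient x (insert b I) k / (t - x k)) =
      (\<Sum>k\<in>I. ?R k / (t - x k)) +
      ((\<Sum>k\<in>I. ?R k / (x b - x k)) - (\<Sum>k\<in>I. ?R k / (t - x k))) / (t - x b)" .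
  have ne: "t - x b \<noteq> 0" using tb by simp
  show ?case
    using insert.hyps ne
    by (simp add: S IHt shift_quotient_insert_same IHb) (simp add: divide_simps, simp add: algebra_simps)
qed simp

lemma sum_shift_quotient:
  assumes "finite I" "inj_on x I"
  shows "(\<Sum>k\<in>I. shift_quotient x I k) = real (card I)"
  using assms
proof (induction I rule: finite_induct)
  case (insert b I)
  have xb: "x b \<notin> x ` I" and inj: "inj_on x I"
    using insert.prems insert.hyps by auto
  have "shift_quotient x (insert b I) k = shift_quotient x I k + shift_quotient x I k / (x b - x k)"
    if "k \<in> I" for k
  proof -
    have "x k \<noteq> x b"
      using xb that by (metis image_eqI)
    then have "1 / (x k - x b) = - (1 / (x b - x k))"
      by (simp add: divide_simps)
    then show ?thesis
      unfolding shift_quotient_insert[OF insert.hyps(1,2) that]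
      by (simp only: minus_minus diff_minus_eq_add distrib_left mult_1_right times_divide_eq_right)
  qed
  then have "(\<Sum>k\<in>I. shift_quotient x (insert b I) k) =
      (\<Sum>k\<in>I. shift_quotient x I k + shift_quotient x I k / (x b - x k))"
    by (rule sum.cong[OF refl])
  then show ?case
    using insert.hyps insert.IH[OF inj]
    by (simp add: sum.distrib shift_quotient_insert_same
        shift_quotient_partial_fractions[OF insert.hyps(1) inj xb])
qed simp

text \<open>
  Through this identity the dimension formula satisfies the branching rule: with \<open>x k\<close> the
  row lengths shifted to distinct numbers, the right side is the number of boxes.
\<close>

lemma sum_mult_shift_quotient:
  assumes "finite I" "inj_on x I"
  shows "(\<Sum>k\<in>I. x k * shift_quotient x I k) =
    (\<Sum>k\<in>I. x k) - real (card I) * (real (card I) - 1) / 2"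
  using assms
proof (induction I rule: finite_induct)
  case (insert b I)
  let ?R = "shift_quotient x I"
  have xb: "x b \<notin> x ` I" and inj: "inj_on x I"
    using insert.prems insert.hyps by auto
  have "x k * shift_quotient x (insert b I) k = x k * ?R k - ?R k + x b * (?R k / (x b - x k))"
    if "k \<in> I" for k
  proof -
    have "x k \<noteq> x b"
      using xb that by (metis image_eqI)
    then have ne: "x b - x k \<noteq> 0" "x k - x b \<noteq> 0"
      by auto
    show ?thesis
      unfolding shift_quotient_insert[OF insert.hyps(1,2) that]
      using ne by (simp add: divide_simps) (simp add: algebra_simps)
  qed
  then have "(\<Sum>k\<in>I. x k * shift_quotient x (insert b I) k) =
      (\<Sum>k\<in>I. x k * ?R k - ?R k + x b * (?R k / (x b - x k)))"
    by (rule sum.cong[OF refl])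
  also have "\<dots> = (\<Sum>k\<in>I. x k * ?R k) - real (card I) + x b * (\<Sum>k\<in>I. ?R k / (x b - x k))"
    by (simp add: sum.distrib sum_subtractf sum_distrib_left sum_shift_quotient[OF insert.hyps(1) inj])
  finally show ?case
    using insert.hyps insert.IH[OF inj]
    by (simp add: shift_quotient_insert_same
        shift_quotient_partial_fractions[OF insert.hyps(1) inj xb]) (simp add: field_simps)
qed simp

section \<open>Corners and the branching rule\<close>

definition diagram_corners :: "(nat \<times> nat) set \<Rightarrow> (nat \<times> nat) set" where
  "diagram_corners \<nu> = {(i, j) \<in> \<nu>. (Suc i, j) \<notin> \<nu> \<and> (i, Suc j) \<notin> \<nu>}"

lemma young_diagram_downward_closed:
  assumes "\<nu> \<in> young_diagrams" "(i, j) \<in> \<nu>" "1 \<le> i'" "i' \<le> i" "1 \<le> j'" "j' \<le> j"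
  shows "(i', j') \<in> \<nu>"
  using assms by (force simp: young_diagrams_def)

lemma young_diagram_pos:
  assumes "\<nu> \<in> young_diagrams" "(i, j) \<in> \<nu>"
  shows "1 \<le> i" "1 \<le> j"
  using assms by (auto simp: young_diagrams_def)

lemma finite_diagram_corners: "\<nu> \<in> young_diagrams \<Longrightarrow> finite (diagram_corners \<nu>)"
  by (rule finite_subset[OF _ finite_young_diagram]) (auto simp: diagram_corners_def)

lemma remove_corner_young:
  assumes "\<nu> \<in> young_diagrams" "b \<in> diagram_corners \<nu>"
  shows "\<nu> - {b} \<in> young_diagrams"
proof -
  obtain p q where b: "b = (p, q)" "(p, q) \<in> \<nu>" "(Suc p, q) \<notin> \<nu>" "(p, Suc q) \<notin> \<nu>"
    using assms(2) by (auto simp: diagram_corners_def)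
  have "(i', j') \<noteq> (p, q)"
    if "(i, j) \<in> \<nu>" "(i, j) \<noteq> (p, q)" "1 \<le> i'" "i' \<le> i" "1 \<le> j'" "j' \<le> j" for i j i' j'
  proof
    assume eq: "(i', j') = (p, q)"
    then have "Suc p \<le> i \<or> Suc q \<le> j"
      using that by auto
    then show False
      using young_diagram_downward_closed[OF assms(1) that(1), of "Suc p" q]
        young_diagram_downward_closed[OF assms(1) that(1), of p "Suc q"] that eq b(3,4) by auto
  qed
  note ne = this
  have "{1..i} \<times> {1..j} \<subseteq> \<nu> - {b}" if ij: "(i, j) \<in> \<nu> - {b}" for i j
  proof
    fix c assume "c \<in> {1..i} \<times> {1..j}"
    then obtain i' j' where c: "c = (i', j')" "1 \<le> i'" "i' \<le> i" "1 \<le> j'" "j' \<le> j"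
      by auto
    have "(i, j) \<in> \<nu>" "(i, j) \<noteq> (p, q)"
      using ij b(1) by auto
    then have "(i', j') \<in> \<nu>" "(i', j') \<noteq> (p, q)"
      using young_diagram_downward_closed[OF assms(1), of i j i' j'] ne[of i j i' j'] c(2-5) by auto
    then show "c \<in> \<nu> - {b}"
      unfolding c(1) b(1) by simp
  qed
  moreover have "finite (\<nu> - {b})"
    using finite_young_diagram[OF assms(1)] by simp
  ultimately show ?thesis
    using young_diagram_pos[OF assms(1)] unfolding young_diagrams_def by blast
qed

text \<open>
  Removing the box with the largest entry is the branching rule, so this box must be a corner.
\<close>

lemma standard_tableaux_max_corner:
  assumes T: "T \<in> standard_tableaux \<nu>" and b: "b \<in> \<nu>" "T b = card \<nu>"
  shows "b \<in> diagram_corners \<nu>"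
proof -
  obtain p q where pq: "b = (p, q)"
    by (cases b)
  have "T c \<le> card \<nu>" if "c \<in> \<nu>" for c
    using T that by (auto simp: standard_tableaux_def)
  then have "\<not> T (p, q) < T c" if "c \<in> \<nu>" for c
    using b that unfolding pq by (simp add: not_less)
  then show ?thesis
    using T b(1) unfolding pq diagram_corners_def standard_tableaux_def by blast
qed

lemma remove_corner_tableaux:
  assumes fin: "finite \<nu>" and b: "b \<in> diagram_corners \<nu>"
  shows "bij_betw (\<lambda>T. restrict T (\<nu> - {b})) {T \<in> standard_tableaux \<nu>. T b = card \<nu>}
           (standard_tableaux (\<nu> - {b}))"
proof -
  have bl: "b \<in> \<nu>"
    using b by (auto simp: diagram_corners_def)
  define n where "n = card (\<nu> - {b})"
  have n: "card \<nu> = Suc n"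
    using fin bl unfolding n_def by (rule card.remove)
  have ins: "{1..Suc n} = insert (Suc n) {1..n}" "Suc n \<notin> {1..n}"
    by auto
  show ?thesis
  proof (rule bij_betw_byWitness[where f' = "\<lambda>S. S(b := card \<nu>)"])
    show "\<forall>T\<in>{T \<in> standard_tableaux \<nu>. T b = card \<nu>}. (restrict T (\<nu> - {b}))(b := card \<nu>) = T"
      by (auto simp: standard_tableaux_def fun_eq_iff restrict_def PiE_def extensional_def)
    show "\<forall>S\<in>standard_tableaux (\<nu> - {b}). restrict (S(b := card \<nu>)) (\<nu> - {b}) = S"
      by (auto simp: standard_tableaux_def fun_eq_iff restrict_def PiE_def extensional_def)
    show "(\<lambda>T. restrict T (\<nu> - {b})) ` {T \<in> standard_tableaux \<nu>. T b = card \<nu>}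
        \<subseteq> standard_tableaux (\<nu> - {b})"
    proof clarify
      fix T assume T: "T \<in> standard_tableaux \<nu>" and Tb: "T b = card \<nu>"
      have "bij_betw T \<nu> {1..Suc n}"
        using T by (simp add: standard_tableaux_def n)
      then have "bij_betw T (\<nu> - {b}) ({1..Suc n} - {T b})"
        using bl by (intro bij_betw_DiffI) (auto simp: bij_betw_def)
      then have bij: "bij_betw T (\<nu> - {b}) {1..n}"
        using Tb ins by (simp add: n)
      then have "bij_betw (restrict T (\<nu> - {b})) (\<nu> - {b}) {1..n}"
        by (rule bij_betw_cong[THEN iffD1, rotated]) simp
      moreover have "restrict T (\<nu> - {b}) \<in> (\<nu> - {b}) \<rightarrow>\<^sub>E {1..n}"
        using bij by (auto simp: bij_betw_def)
      ultimately show "restrict T (\<nu> - {b}) \<in> standard_tableaux (\<nu> - {b})"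
        using T by (simp add: standard_tableaux_def n_def)
    qed
    show "(\<lambda>S. S(b := card \<nu>)) ` standard_tableaux (\<nu> - {b})
        \<subseteq> {T \<in> standard_tableaux \<nu>. T b = card \<nu>}"
    proof (clarify, intro conjI)
      fix S assume S: "S \<in> standard_tableaux (\<nu> - {b})"
      have bijS: "bij_betw S (\<nu> - {b}) {1..n}" and PiS: "S \<in> (\<nu> - {b}) \<rightarrow>\<^sub>E {1..n}"
        using S by (auto simp: standard_tableaux_def n_def)
      have le: "S c < Suc n" if "c \<in> \<nu>" "c \<noteq> b" for c
        using PiE_mem[OF PiS, of c] that by simp
      have nu: "insert b (\<nu> - {b}) = \<nu>"
        using bl by auto
      have "bij_betw (S(b := Suc n)) (\<nu> - {b}) {1..n}"
        using bijS by (rule bij_betw_cong[THEN iffD1, rotated]) auto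
      then have "bij_betw (S(b := Suc n)) (insert b (\<nu> - {b})) (insert (Suc n) {1..n})"
        using notIn_Un_bij_betw3[of b "\<nu> - {b}" "S(b := Suc n)" "{1..n}"] by simp
      then have "bij_betw (S(b := Suc n)) \<nu> {1..Suc n}"
        by (simp only: nu ins)
      moreover have "S(b := Suc n) \<in> \<nu> \<rightarrow>\<^sub>E {1..Suc n}"
        using PiS bl le by (auto simp: PiE_def Pi_def extensional_def intro: le_SucI)
      moreover have "(S(b := Suc n)) (i, j) < (S(b := Suc n)) c"
        if "(i, j) \<in> \<nu>" "c \<in> \<nu>" "c = (i, Suc j) \<or> c = (Suc i, j)" for i j c
      proof -
        have "b \<noteq> (i, j)"
          using b that by (auto simp: diagram_corners_def)
        then show ?thesis
          using S that le[of "(i, j)"] by (auto simp: standard_tableaux_def)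
      qed
      ultimately show "S(b := card \<nu>) \<in> standard_tableaux \<nu>"
        unfolding standard_tableaux_def n by blast
    qed simp
  qed
qed

text \<open>
  Sort the tableaux by the position of their largest entry.
\<close>

lemma dim_diagram_branching:
  assumes "\<nu> \<in> young_diagrams" "\<nu> \<noteq> {}"
  shows "dim_diagram \<nu> = (\<Sum>b\<in>diagram_corners \<nu>. dim_diagram (\<nu> - {b}))"
proof -
  have fin: "finite \<nu>"
    using assms(1) by (rule finite_young_diagram)
  have finT: "finite (standard_tableaux \<nu>)"
    by (rule finite_subset[of _ "\<nu> \<rightarrow>\<^sub>E {1..card \<nu>}"])
      (auto simp: standard_tableaux_def fin intro: finite_PiE)
  have "standard_tableaux \<nu> = (\<Union>b\<in>diagram_corners \<nu>. {T \<in> standard_tableaux \<nu>. T b = card \<nu>})"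
  proof -
    have "\<exists>b\<in>diagram_corners \<nu>. T b = card \<nu>" if T: "T \<in> standard_tableaux \<nu>" for T
    proof -
      have "card \<nu> \<in> T ` \<nu>"
        using T assms(2) fin by (auto simp: standard_tableaux_def bij_betw_def Suc_le_eq card_gt_0_iff)
      then show ?thesis
        using standard_tableaux_max_corner[OF T] by force
    qed
    then show ?thesis by blast
  qed
  then have "dim_diagram \<nu> =
      card (\<Union>b\<in>diagram_corners \<nu>. {T \<in> standard_tableaux \<nu>. T b = card \<nu>})"
    unfolding dim_diagram_def by simp
  also have "\<dots> = (\<Sum>b\<in>diagram_corners \<nu>. card {T \<in> standard_tableaux \<nu>. T b = card \<nu>})"
  proof (rule card_UN_disjoint)
    have "{T \<in> standard_tableaux \<nu>. T b = card \<nu>} \<inter>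
        {T \<in> standard_tableaux \<nu>. T c = card \<nu>} = {}"
      if bc: "b \<in> diagram_corners \<nu>" "c \<in> diagram_corners \<nu>" "b \<noteq> c" for b c
    proof -
      have Tne: "T b \<noteq> T c" if "T \<in> standard_tableaux \<nu>" for T
        using that bc by (auto simp: standard_tableaux_def bij_betw_def inj_on_def diagram_corners_def)
      show ?thesis
        using Tne by (intro equals0I) (clarsimp, metis)
    qed
    then show "\<forall>b\<in>diagram_corners \<nu>. \<forall>c\<in>diagram_corners \<nu>. b \<noteq> c \<longrightarrow>
        {T \<in> standard_tableaux \<nu>. T b = card \<nu>} \<inter>
        {T \<in> standard_tableaux \<nu>. T c = card \<nu>} = {}"
      by blast
  qed (use finT in \<open>auto intro: finite_diagram_corners[OF assms(1)]\<close>)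
  also have "\<dots> = (\<Sum>b\<in>diagram_corners \<nu>. dim_diagram (\<nu> - {b}))"
    unfolding dim_diagram_def
    by (intro sum.cong refl bij_betw_same_card[OF remove_corner_tableaux[OF fin]])
  finally show ?thesis .
qed

section \<open>The dimension of a diagram in terms of signatures\<close>

text \<open>
  The content of the box in row \<open>i\<close> and column \<open>j\<close> is \<open>j - i\<close>. All products over boxes below, including
  the Gamma quotients and the dominating function, are of this form for a suitable \<open>f\<close>.
\<close>

definition content_product :: "(int \<Rightarrow> 'a::comm_monoid_mult) \<Rightarrow> (nat \<times> nat) set \<Rightarrow> 'a" where
  "content_product f \<nu> = (\<Prod>(i, j)\<in>\<nu>. f (int j - int i))"

lemma content_product_remove:
  assumes "finite \<nu>" "(i, j) \<in> \<nu>"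
  shows "content_product f \<nu> = f (int j - int i) * content_product f (\<nu> - {(i, j)})"
  unfolding content_product_def by (subst prod.remove[OF assms]) simp

lemma content_product_rows:
  "content_product f (diagram_of_signature N \<mu>) =
     (\<Prod>i = 1..N. \<Prod>j = 1..nat (\<mu> i). f (int j - int i))"
  unfolding content_product_def diagram_of_signature_def by (simp add: prod.Sigma)

definition shifted_row :: "nat \<Rightarrow> (nat \<Rightarrow> int) \<Rightarrow> nat \<Rightarrow> real" where
  "shifted_row N \<mu> i = real_of_int (\<mu> i) + real N - real i"

lemma Dim_signature_shifted_row:
  "Dim_signature N \<mu> = (\<Prod>(i, j) | 1 \<le> i \<and> i < j \<and> j \<le> N.
     (shifted_row N \<mu> i - shifted_row N \<mu> j) / (real j - real i))"
  unfolding Dim_signature_def shifted_row_def by (rule arg_cong2[where f = prod]) (auto simp: algebra_simps)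

lemma signatures_antimono:
  assumes "\<mu> \<in> signatures N" "1 \<le> i" "i \<le> j" "j \<le> N"
  shows "\<mu> j \<le> \<mu> i"
  using assms by (auto simp: signatures_def)

lemma inj_on_shifted_row:
  assumes "\<mu> \<in> signatures N"
  shows "inj_on (shifted_row N \<mu>) {1..N}"
proof (rule linorder_inj_onI)
  fix i j assume ij: "i < j" "i \<in> {1..N}" "j \<in> {1..N}"
  then have "\<mu> j \<le> \<mu> i"
    using signatures_antimono[OF assms] by auto
  then have "real_of_int (\<mu> j) \<le> real_of_int (\<mu> i)" "real i < real j"
    using ij by auto
  then show "shifted_row N \<mu> i \<noteq> shifted_row N \<mu> j"
    unfolding shifted_row_def by linarith
qed auto

text \<open>
  The dimension is a Vandermonde product in the shifted rows, up to a constant.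
\<close>

lemma Dim_signature_lower_row:
  assumes \<mu>: "\<mu> \<in> signatures N" and k: "k \<in> {1..N}"
  shows "Dim_signature N (\<mu>(k := \<mu> k - 1)) =
     Dim_signature N \<mu> * shift_quotient (shifted_row N \<mu>) {1..N} k"
proof -
  define P where "P = {(i, j). 1 \<le> i \<and> i < j \<and> j \<le> N}"
  define l where "l = shifted_row N \<mu>"
  define l' where "l' = shifted_row N (\<mu>(k := \<mu> k - 1))"
  define c where "c = (\<lambda>j. 1 - 1 / (l k - l j))"
  \<comment> \<open>Only the pairs containing \<open>k\<close> change, and \<open>h\<close> matches them with the other index.\<close>
  define h where "h = (\<lambda>j. if j < k then (j, k) else (k, j))"
  define g where "g = (\<lambda>(i, j). if i = k then c j else if j = k then c i else 1)"
  have finP: "finite P"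
    by (rule finite_subset[of _ "{1..N} \<times> {1..N}"]) (auto simp: P_def)
  have l': "l' i = (if i = k then l k - 1 else l i)" for i
    by (auto simp: l'_def l_def shifted_row_def)
  have inj: "inj_on l {1..N}"
    unfolding l_def by (rule inj_on_shifted_row[OF \<mu>])
  have factor: "(l' i - l' j) / (real j - real i) = (l i - l j) / (real j - real i) * g (i, j)"
    if ij: "1 \<le> i" "i < j" "j \<le> N" for i j
  proof -
    have ne: "l i \<noteq> l j" "real j \<noteq> real i"
      using inj_onD[OF inj, of i j] ij by auto
    have "l' i - l' j = (l i - l j) * g (i, j)"
      using ne ij by (auto simp: l' g_def c_def field_simps)
    then show ?thesis by simp
  qed
  have "Dim_signature N (\<mu>(k := \<mu> k - 1)) =
      (\<Prod>(i, j)\<in>P. (l i - l j) / (real j - real i) * g (i, j))"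
    unfolding Dim_signature_shifted_row P_def[symmetric] l'_def[symmetric]
    by (rule prod.cong[OF refl]) (use factor in \<open>auto simp: P_def\<close>)
  also have "\<dots> = (\<Prod>p\<in>P. (case p of (i, j) \<Rightarrow> (l i - l j) / (real j - real i)) * g p)"
    by (rule prod.cong[OF refl]) (simp only: split_paired_all prod.case)
  also have "\<dots> = Dim_signature N \<mu> * prod g P"
    unfolding Dim_signature_shifted_row P_def[symmetric] l_def[symmetric] by (rule prod.distrib)
  also have "prod g P = prod g (h ` ({1..N} - {k}))"
    by (rule prod.mono_neutral_right[OF finP])
      (use k in \<open>auto simp: P_def h_def g_def image_iff split: if_splits\<close>)
  also have "\<dots> = prod (g \<circ> h) ({1..N} - {k})"
    by (rule prod.reindex) (auto simp: inj_on_def h_def split: if_splits)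
  also have "\<dots> = (\<Prod>j\<in>{1..N} - {k}. c j)"
    by (rule prod.cong) (auto simp: g_def h_def)
  finally show ?thesis
    unfolding shift_quotient_def c_def l_def .
qed

text \<open>
  The rows whose last box is a corner.
\<close>

definition lowerable_rows :: "nat \<Rightarrow> (nat \<Rightarrow> int) \<Rightarrow> nat set" where
  "lowerable_rows N \<mu> = {k \<in> {1..N}. 0 < \<mu> k \<and> (k < N \<longrightarrow> \<mu> (Suc k) < \<mu> k)}"

lemma diagram_corners_signature:
  assumes "\<mu> \<in> signatures N"
  shows "diagram_corners (diagram_of_signature N \<mu>) = (\<lambda>k. (k, nat (\<mu> k))) ` lowerable_rows N \<mu>"
proof (intro equalityI subsetI)
  fix b assume "b \<in> diagram_corners (diagram_of_signature N \<mu>)"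
  then show "b \<in> (\<lambda>k. (k, nat (\<mu> k))) ` lowerable_rows N \<mu>"
    by (cases b) (auto simp: diagram_corners_def diagram_of_signature_def lowerable_rows_def image_iff)
next
  fix b assume "b \<in> (\<lambda>k. (k, nat (\<mu> k))) ` lowerable_rows N \<mu>"
  then show "b \<in> diagram_corners (diagram_of_signature N \<mu>)"
    by (auto simp: diagram_corners_def diagram_of_signature_def lowerable_rows_def)
qed

lemma lower_row_signature:
  assumes "\<mu> \<in> signatures N" "\<forall>i\<in>{1..N}. 0 \<le> \<mu> i" "k \<in> lowerable_rows N \<mu>"
  shows "\<mu>(k := \<mu> k - 1) \<in> signatures N"
    and "\<forall>i\<in>{1..N}. 0 \<le> (\<mu>(k := \<mu> k - 1)) i"
    and "diagram_of_signature N (\<mu>(k := \<mu> k - 1)) = diagram_of_signature N \<mu> - {(k, nat (\<mu> k))}"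
proof -
  have k: "k \<in> {1..N}" "0 < \<mu> k" "k < N \<longrightarrow> \<mu> (Suc k) < \<mu> k"
    using assms(3) by (auto simp: lowerable_rows_def)
  have "\<mu> j < \<mu> k" if "k < j" "j \<le> N" for j
    using k signatures_antimono[OF assms(1), of "Suc k" j] that by auto
  then have "(\<mu>(k := \<mu> k - 1)) j \<le> (\<mu>(k := \<mu> k - 1)) i" if "1 \<le> i" "i \<le> j" "j \<le> N" for i j
    using that signatures_antimono[OF assms(1) that] by (cases "i = k"; cases "j = k") force+
  moreover have "\<mu>(k := \<mu> k - 1) \<in> {1..N} \<rightarrow>\<^sub>E UNIV"
    using assms(1) k(1) by (auto simp: signatures_def PiE_def extensional_def)
  ultimately show "\<mu>(k := \<mu> k - 1) \<in> signatures N"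
    by (simp add: signatures_def)
  show "\<forall>i\<in>{1..N}. 0 \<le> (\<mu>(k := \<mu> k - 1)) i"
    using assms(2) k by auto
  have "{1..nat (\<mu> k - 1)} = {1..nat (\<mu> k)} - {nat (\<mu> k)}"
    by auto
  then show "diagram_of_signature N (\<mu>(k := \<mu> k - 1)) = diagram_of_signature N \<mu> - {(k, nat (\<mu> k))}"
    unfolding diagram_of_signature_def by (auto simp: set_eq_iff split: if_splits)
qed

text \<open>
  If row \<open>k\<close> cannot be shortened, then its shifted length minus 1 equals the next shifted length, or
  it is the empty last row with shifted length 0. This lets sums over corners run over all rows.
\<close>

lemma not_lowerable_row:
  assumes \<mu>: "\<mu> \<in> signatures N" "\<forall>i\<in>{1..N}. 0 \<le> \<mu> i" and k: "k \<in> {1..N} - lowerable_rows N \<mu>"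
  shows "shifted_row N \<mu> k * shift_quotient (shifted_row N \<mu>) {1..N} k = 0"
proof (cases "k < N")
  case True
  then have "\<mu> (Suc k) \<le> \<mu> k" "0 \<le> \<mu> (Suc k)"
    using signatures_antimono[OF \<mu>(1), of k "Suc k"] \<mu>(2) k by auto
  then have "\<mu> (Suc k) = \<mu> k"
    using k True by (auto simp: lowerable_rows_def)
  then have "shifted_row N \<mu> k - shifted_row N \<mu> (Suc k) = 1"
    by (simp add: shifted_row_def)
  then have "shift_quotient (shifted_row N \<mu>) {1..N} k = 0"
    unfolding shift_quotient_def using True k by (intro prod_zero bexI[of _ "Suc k"]) auto
  then show ?thesis by simp
next
  case False
  then have kN: "k = N"
    using k by auto
  have "0 \<le> \<mu> N"
    using \<mu>(2) k kN by blast
  moreover have "\<not> 0 < \<mu> N"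
    using k kN by (simp add: lowerable_rows_def)
  ultimately have "\<mu> N = 0"
    by linarith
  then show ?thesis
    by (simp add: shifted_row_def kN)
qed

lemma card_diagram_of_signature:
  assumes "\<forall>i\<in>{1..N}. 0 \<le> \<mu> i"
  shows "real (card (diagram_of_signature N \<mu>)) = (\<Sum>i = 1..N. real_of_int (\<mu> i))"
proof -
  have "card (diagram_of_signature N \<mu>) = (\<Sum>i = 1..N. nat (\<mu> i))"
    by (simp add: diagram_of_signature_def)
  then show ?thesis
    using assms by simp
qed

lemma sum_shifted_row:
  "(\<Sum>i = 1..N. shifted_row N \<mu> i) =
     (\<Sum>i = 1..N. real_of_int (\<mu> i)) + real N * (real N - 1) / 2"
proof -
  have "(\<Sum>i = 1..N. real N - real i) = real N * (real N - 1) / 2"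
    by (induction N) (auto simp: sum_subtractf field_simps)
  then show ?thesis
    unfolding shifted_row_def by (simp add: sum.distrib diff_add_eq_diff_diff_swap add_diff_eq[symmetric])
qed

text \<open>
  Both sides are 1 for the empty diagram and satisfy the same recursion when a box is removed: the
  left side by the branching rule, the right side because shortening row \<open>k\<close> multiplies it by
  the shifted row length, which is the factor of the removed box in the denominator, times the
  Vandermonde quotient. The weights add up to the number of boxes by \<open>sum_mult_shift_quotient\<close>.
\<close>

lemma dim_diagram_eq_Dim_signature:
  assumes "\<mu> \<in> signatures N" "\<forall>i\<in>{1..N}. 0 \<le> \<mu> i"
  shows "real (dim_diagram (diagram_of_signature N \<mu>)) / fact (card (diagram_of_signature N \<mu>)) =
     Dim_signature N \<mu> / content_product (\<lambda>c. real N + of_int c) (diagram_of_signature N \<mu>)"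
  using assms
proof (induction "card (diagram_of_signature N \<mu>)" arbitrary: \<mu>)
  case 0
  let ?\<nu> = "diagram_of_signature N \<mu>"
  have fin: "finite ?\<nu>"
    by (simp add: diagram_of_signature_def)
  have empty: "?\<nu> = {}"
    using 0 fin by simp
  have \<mu>0: "\<mu> i = 0" if "i \<in> {1..N}" for i
  proof -
    have "nat (\<mu> i) = 0"
    proof (rule ccontr)
      assume "nat (\<mu> i) \<noteq> 0"
      then have "(i, 1) \<in> ?\<nu>"
        using that by (auto simp: diagram_of_signature_def)
      then show False using empty by simp
    qed
    moreover have "0 \<le> \<mu> i"
      using 0(3) that by blast
    ultimately show ?thesis
      by simp
  qed
  have "Dim_signature N \<mu> = 1"
    unfolding Dim_signature_def by (rule prod.neutral) (auto simp: \<mu>0)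
  moreover have "standard_tableaux {} = {\<lambda>_. undefined}"
    by (auto simp: standard_tableaux_def bij_betw_def)
  ultimately show ?case
    by (simp add: empty content_product_def dim_diagram_def)
next
  case (Suc n)
  let ?\<nu> = "diagram_of_signature N \<mu>"
  let ?l = "shifted_row N \<mu>" and ?L = "lowerable_rows N \<mu>"
  let ?cp = "content_product (\<lambda>c. real N + of_int c)"
  let ?H = "Dim_signature N \<mu> / ?cp ?\<nu>"
  have fin: "finite ?\<nu>" and young: "?\<nu> \<in> young_diagrams"
    using diagram_of_signature_young[OF Suc(3)] finite_young_diagram by auto
  have ne: "?\<nu> \<noteq> {}"
    using Suc(2) by auto
  have summand: "real (dim_diagram (?\<nu> - {(k, nat (\<mu> k))})) / fact n =
      ?H * (?l k * shift_quotient ?l {1..N} k)" if k: "k \<in> ?L" for k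
  proof -
    have k': "k \<in> {1..N}" "0 < \<mu> k"
      using k by (auto simp: lowerable_rows_def)
    then have mem: "(k, nat (\<mu> k)) \<in> ?\<nu>"
      by (auto simp: diagram_of_signature_def)
    note low = lower_row_signature[OF Suc(3,4) k]
    have card: "card (?\<nu> - {(k, nat (\<mu> k))}) = n"
      using Suc(2) mem fin by simp
    have "?cp ?\<nu> = ?l k * ?cp (?\<nu> - {(k, nat (\<mu> k))})"
      using content_product_remove[OF fin mem, of "\<lambda>c. real N + of_int c"] k'
      by (simp add: shifted_row_def algebra_simps)
    moreover have "?l k \<noteq> 0"
      using k' by (simp add: shifted_row_def)
    moreover have "real (dim_diagram (?\<nu> - {(k, nat (\<mu> k))})) / fact n =
        Dim_signature N (\<mu>(k := \<mu> k - 1)) / ?cp (?\<nu> - {(k, nat (\<mu> k))})"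
      using Suc(1)[of "\<mu>(k := \<mu> k - 1)"] low card by simp
    ultimately show ?thesis
      using Dim_signature_lower_row[OF Suc(3) k'(1)] by simp
  qed
  have inj: "inj_on (\<lambda>k. (k, nat (\<mu> k))) ?L"
    by (auto simp: inj_on_def)
  have "real (dim_diagram ?\<nu>) / fact n =
      (\<Sum>k\<in>?L. real (dim_diagram (?\<nu> - {(k, nat (\<mu> k))})) / fact n)"
    unfolding dim_diagram_branching[OF young ne] diagram_corners_signature[OF Suc(3)]
    by (simp add: sum.reindex[OF inj] sum_divide_distrib)
  also have "\<dots> = (\<Sum>k\<in>?L. ?H * (?l k * shift_quotient ?l {1..N} k))"
    by (rule sum.cong[OF refl summand])
  also have "\<dots> = (\<Sum>k = 1..N. ?H * (?l k * shift_quotient ?l {1..N} k))"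
    by (rule sum.mono_neutral_left)
      (use not_lowerable_row[OF Suc(3,4)] in \<open>auto simp: lowerable_rows_def\<close>)
  also have "\<dots> = ?H * (\<Sum>k = 1..N. ?l k * shift_quotient ?l {1..N} k)"
    by (simp add: sum_distrib_left)
  also have "(\<Sum>k = 1..N. ?l k * shift_quotient ?l {1..N} k) = real (card ?\<nu>)"
    using sum_mult_shift_quotient[OF finite_atLeastAtMost inj_on_shifted_row[OF Suc(3)]]
    unfolding sum_shifted_row card_diagram_of_signature[OF Suc(4)] by simp
  finally have "real (dim_diagram ?\<nu>) / fact n = ?H * real (Suc n)"
    using Suc(2) by simp
  then have "real (dim_diagram ?\<nu>) / fact n / real (Suc n) = ?H"
    by simp
  then show ?case
    by (simp only: Suc(2)[symmetric] fact_Suc divide_divide_eq_left mult.commute of_nat_mult)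
qed

section \<open>A content bound for the dimension\<close>

text \<open>
  Attach to a corner above the diagonal the boxes of its row right of the diagonal, to a corner
  below the diagonal the boxes of its column below the diagonal, and to a corner on the diagonal
  the corner itself. These sets of boxes are disjoint since a row or column has only one corner.
\<close>

lemma sum_corner_contents_le_card:
  assumes \<nu>: "\<nu> \<in> young_diagrams"
  shows "(\<Sum>(i, j)\<in>diagram_corners \<nu>. max 1 \<bar>real j - real i\<bar>) \<le> real (card \<nu>)"
proof -
  \<comment> \<open>The boxes attached to the corner \<open>(i, j)\<close>.\<close>
  define S where "S = (\<lambda>(i, j). if i < j then {i} \<times> {i<..j} else if j < i then {j<..i} \<times> {j}
    else {(i, j)} :: (nat \<times> nat) set)"
  have fin: "finite \<nu>"
    using \<nu> by (rule finite_young_diagram)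
  have finS: "finite (S b)" for b
    by (cases b) (auto simp: S_def)
  have card_S: "real (card (S (i, j))) = max 1 \<bar>real j - real i\<bar>" for i j
    by (auto simp: S_def card_cartesian_product of_nat_diff max_def abs_if)
  have sub: "S b \<subseteq> \<nu>" if b: "b \<in> diagram_corners \<nu>" for b
  proof -
    obtain i j where ij: "b = (i, j)" "(i, j) \<in> \<nu>"
      using b by (auto simp: diagram_corners_def)
    show ?thesis
    proof
      fix c assume c: "c \<in> S b"
      obtain i' j' where c': "c = (i', j')" by (cases c)
      have "1 \<le> i'" "i' \<le> i" "1 \<le> j'" "j' \<le> j"
        using c young_diagram_pos[OF \<nu> ij(2)] by (auto simp: S_def ij(1) c' split: if_splits)
      then show "c \<in> \<nu>"
        unfolding c' by (rule young_diagram_downward_closed[OF \<nu> ij(2)])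
    qed
  qed
  have row: "j = j'" if "(i, j) \<in> diagram_corners \<nu>" "(i, j') \<in> diagram_corners \<nu>" for i j j'
  proof (rule ccontr)
    assume "j \<noteq> j'"
    then have "Suc j \<le> j' \<or> Suc j' \<le> j" by auto
    then show False
      using that young_diagram_downward_closed[OF \<nu>, of i j' i "Suc j"]
        young_diagram_downward_closed[OF \<nu>, of i j i "Suc j'"] young_diagram_pos[OF \<nu>]
      by (auto simp: diagram_corners_def)
  qed
  have col: "i = i'" if "(i, j) \<in> diagram_corners \<nu>" "(i', j) \<in> diagram_corners \<nu>" for i i' j
  proof (rule ccontr)
    assume "i \<noteq> i'"
    then have "Suc i \<le> i' \<or> Suc i' \<le> i" by auto
    then show False
      using that young_diagram_downward_closed[OF \<nu>, of i' j "Suc i" j]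
        young_diagram_downward_closed[OF \<nu>, of i j "Suc i'" j] young_diagram_pos[OF \<nu>]
      by (auto simp: diagram_corners_def)
  qed
  have disj: "S b \<inter> S c = {}" if "b \<in> diagram_corners \<nu>" "c \<in> diagram_corners \<nu>" "b \<noteq> c" for b c
  proof -
    obtain i j i' j' where bc: "b = (i, j)" "c = (i', j')"
      by (cases b, cases c)
    have "i \<noteq> i'" "j \<noteq> j'"
      using row[of i j j'] col[of i j i'] that bc by auto
    then show ?thesis
      by (auto simp: S_def bc split: if_splits)
  qed
  have "(\<Sum>(i, j)\<in>diagram_corners \<nu>. max 1 \<bar>real j - real i\<bar>) = real (\<Sum>b\<in>diagram_corners \<nu>. card (S b))"
    unfolding of_nat_sum by (rule sum.cong) (auto simp: card_S)
  also have "(\<Sum>b\<in>diagram_corners \<nu>. card (S b)) = card (\<Union>b\<in>diagram_corners \<nu>. S b)"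
    by (rule card_UN_disjoint[symmetric]) (use finite_diagram_corners[OF \<nu>] finS disj in auto)
  also have "\<dots> \<le> card \<nu>"
    using sub by (intro card_mono fin) auto
  finally show ?thesis by simp
qed

text \<open>
  The content product is the product of the factorials of all arms and legs of diagonal boxes, so
  this is the bound of \<open>dim \<nu>\<close> by a multinomial coefficient. By the branching rule, induction
  on the number of boxes reduces it to the previous lemma.
\<close>

lemma dim_diagram_content_bound:
  assumes "\<nu> \<in> young_diagrams"
  shows "real (dim_diagram \<nu>) * content_product (\<lambda>c. max 1 \<bar>real_of_int c\<bar>) \<nu> \<le> fact (card \<nu>)"
  using assms
proof (induction "card \<nu>" arbitrary: \<nu>)
  case 0
  then have "\<nu> = {}"
    using finite_young_diagram by simp
  moreover have "standard_tableaux {} = {\<lambda>_. undefined}"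
    by (auto simp: standard_tableaux_def bij_betw_def)
  ultimately show ?case
    by (simp add: dim_diagram_def content_product_def)
next
  case (Suc n)
  let ?C = "content_product (\<lambda>c. max 1 \<bar>real_of_int c\<bar>)"
  have fin: "finite \<nu>" and ne: "\<nu> \<noteq> {}"
    using Suc finite_young_diagram by auto
  have "real (dim_diagram \<nu>) * ?C \<nu> = (\<Sum>b\<in>diagram_corners \<nu>. real (dim_diagram (\<nu> - {b})) * ?C \<nu>)"
    unfolding dim_diagram_branching[OF Suc(3) ne] by (simp add: sum_distrib_right)
  also have "\<dots> \<le> (\<Sum>b\<in>diagram_corners \<nu>. case b of (i, j) \<Rightarrow> fact n * max 1 \<bar>real j - real i\<bar>)"
  proof (rule sum_mono)
    fix b assume b: "b \<in> diagram_corners \<nu>"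
    obtain i j where ij: "b = (i, j)" by (cases b)
    have mem: "(i, j) \<in> \<nu>"
      using b by (auto simp: diagram_corners_def ij)
    have C: "?C \<nu> = max 1 \<bar>real j - real i\<bar> * ?C (\<nu> - {b})"
      using content_product_remove[OF fin mem, of "\<lambda>c. max 1 \<bar>real_of_int c\<bar>"] by (simp add: ij)
    have "real (dim_diagram (\<nu> - {b})) * ?C (\<nu> - {b}) \<le> fact n"
    proof -
      have "card (\<nu> - {b}) = n"
        using Suc(2) fin mem by (simp add: ij flip: Suc(2))
      then show ?thesis
        using Suc(1)[of "\<nu> - {b}"] remove_corner_young[OF Suc(3) b] by simp
    qed
    then have "max 1 \<bar>real j - real i\<bar> * (real (dim_diagram (\<nu> - {b})) * ?C (\<nu> - {b}))
        \<le> max 1 \<bar>real j - real i\<bar> * fact n"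
      by (rule mult_left_mono) simp
    then show "real (dim_diagram (\<nu> - {b})) * ?C \<nu> \<le> (case b of (i, j) \<Rightarrow> fact n * max 1 \<bar>real j - real i\<bar>)"
      unfolding C ij by (simp add: mult_ac)
  qed
  also have "\<dots> = fact n * (\<Sum>(i, j)\<in>diagram_corners \<nu>. max 1 \<bar>real j - real i\<bar>)"
    by (simp add: sum_distrib_left split_def)
  also have "\<dots> \<le> fact n * real (card \<nu>)"
    using sum_corner_contents_le_card[OF Suc(3)] by (rule mult_left_mono) simp
  also have "\<dots> = fact (card \<nu>)"
    unfolding Suc(2)[symmetric] by (simp only: fact_Suc of_nat_mult mult.commute of_nat_id)
  finally show ?case .
qed

section \<open>Summation over diagrams in Frobenius coordinates\<close>

definition diagonal :: "(nat \<times> nat) set \<Rightarrow> nat set" where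
  "diagonal \<nu> = {i. (i, i) \<in> \<nu>}"

definition arm :: "(nat \<times> nat) set \<Rightarrow> nat \<Rightarrow> nat" where
  "arm \<nu> i = card {j. i < j \<and> (i, j) \<in> \<nu>}"

text \<open>
  The arms of the diagonal boxes. The legs are the arms of the transposed diagram, and the two
  sets together are the Frobenius coordinates.
\<close>

definition frobenius_arms :: "(nat \<times> nat) set \<Rightarrow> nat set" where
  "frobenius_arms \<nu> = arm \<nu> ` diagonal \<nu>"

lemma initial_segment_eq:
  fixes S :: "nat set"
  assumes "finite S" "S \<subseteq> {a<..}" "\<And>j k. j \<in> S \<Longrightarrow> a < k \<Longrightarrow> k \<le> j \<Longrightarrow> k \<in> S"
  shows "S = {a<..a + card S}"
proof (cases "S = {}")
  case False
  then have "Max S \<in> S"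
    using assms(1) by simp
  then have "S = {a<..Max S}"
    using assms(1,2) assms(3)[of "Max S"] by (intro equalityI subsetI) auto
  moreover have "a < Max S"
    using \<open>Max S \<in> S\<close> assms(2) by auto
  ultimately show ?thesis
    by (metis card_greaterThanAtMost le_add_diff_inverse less_imp_le)
qed simp

lemma mem_young_diagram_iff_arm:
  assumes \<nu>: "\<nu> \<in> young_diagrams" and "i \<le> j"
  shows "(i, j) \<in> \<nu> \<longleftrightarrow> i \<in> diagonal \<nu> \<and> j \<le> i + arm \<nu> i"
proof -
  let ?S = "{j. i < j \<and> (i, j) \<in> \<nu>}"
  have "finite ?S"
    by (rule finite_subset[of _ "snd ` \<nu>"])
      (use finite_young_diagram[OF \<nu>] in \<open>auto intro: rev_image_eqI\<close>)
  moreover have "?S \<subseteq> {i<..}"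
    by auto
  moreover have "k \<in> ?S" if "j \<in> ?S" "i < k" "k \<le> j" for j k
    using that young_diagram_downward_closed[OF \<nu>, of i j i k] young_diagram_pos[OF \<nu>, of i j] by auto
  ultimately have S_eq: "?S = {i<..i + arm \<nu> i}"
    unfolding arm_def by (rule initial_segment_eq)
  have S: "(i, j) \<in> \<nu> \<longleftrightarrow> j \<le> i + arm \<nu> i" if "i < j" for j
    using eqset_imp_iff[OF S_eq, of j] that by simp
  have "i \<in> diagonal \<nu>" if "(i, j) \<in> \<nu>"
    unfolding diagonal_def
    using that assms(2) young_diagram_downward_closed[OF \<nu> that, of i i] young_diagram_pos[OF \<nu> that] by auto
  then show ?thesis
    using S[of j] assms(2) by (cases "i = j") (auto simp: diagonal_def)
qed

lemma finite_diagonal: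
  assumes "\<nu> \<in> young_diagrams"
  shows "finite (diagonal \<nu>)"
  by (rule finite_subset[of _ "fst ` \<nu>"])
    (use finite_young_diagram[OF assms] in \<open>auto simp: diagonal_def intro: rev_image_eqI\<close>)

lemma inj_on_arm:
  assumes \<nu>: "\<nu> \<in> young_diagrams"
  shows "inj_on (arm \<nu>) (diagonal \<nu>)"
proof (rule linorder_inj_onI)
  fix i k assume ik: "i < k" "i \<in> diagonal \<nu>" "k \<in> diagonal \<nu>"
  have k: "(k, k + arm \<nu> k) \<in> \<nu>"
    using mem_young_diagram_iff_arm[OF \<nu>, of k "k + arm \<nu> k"] ik by simp
  have "1 \<le> i"
    using ik(2) young_diagram_pos[OF \<nu>, of i i] by (simp add: diagonal_def)
  then have "(i, k + arm \<nu> k) \<in> \<nu>"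
    using ik(1) by (intro young_diagram_downward_closed[OF \<nu> k]) auto
  then have "k + arm \<nu> k \<le> i + arm \<nu> i"
    using mem_young_diagram_iff_arm[OF \<nu>, of i "k + arm \<nu> k"] ik(1) by simp
  then show "arm \<nu> i \<noteq> arm \<nu> k"
    using ik by simp
qed auto

text \<open>
  The arms decrease strictly along the diagonal, so their set determines their sequence: at least
  \<open>i\<close> arms have length at least \<open>m\<close> if and only if the \<open>i\<close>-th one does.
\<close>

lemma mem_young_diagram_iff_frobenius_arms:
  assumes \<nu>: "\<nu> \<in> young_diagrams" and "1 \<le> i"
  shows "(i, i + m) \<in> \<nu> \<longleftrightarrow> i \<le> card {x \<in> frobenius_arms \<nu>. m \<le> x}"
proof -
  define K where "K = {k. (k, k + m) \<in> \<nu>}"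
  have K: "K = {k \<in> diagonal \<nu>. m \<le> arm \<nu> k}"
    unfolding K_def using mem_young_diagram_iff_arm[OF \<nu>] by auto
  have "K = {0<..0 + card K}"
  proof (rule initial_segment_eq)
    show "finite K"
      unfolding K using finite_diagonal[OF \<nu>] by simp
    show "K \<subseteq> {0<..}"
      unfolding K_def using young_diagram_pos[OF \<nu>] by force
    show "k \<in> K" if "j \<in> K" "0 < k" "k \<le> j" for j k
      using that young_diagram_downward_closed[OF \<nu>, of j "j + m" k "k + m"] by (simp add: K_def)
  qed
  moreover have "{x \<in> frobenius_arms \<nu>. m \<le> x} = arm \<nu> ` K"
    unfolding K frobenius_arms_def by auto
  moreover have "card (arm \<nu> ` K) = card K"
    by (rule card_image, rule inj_on_subset[OF inj_on_arm[OF \<nu>]]) (auto simp: K)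
  ultimately show ?thesis
    using assms(2) unfolding K_def by (metis (no_types, lifting) add_0 greaterThanAtMost_iff
        less_eq_Suc_le mem_Collect_eq One_nat_def)
qed

lemma inj_on_frobenius:
  "inj_on (\<lambda>\<nu>. (frobenius_arms \<nu>, frobenius_arms (prod.swap ` \<nu>))) young_diagrams"
proof (rule inj_onI)
  fix \<mu> \<nu> assume *: "\<mu> \<in> young_diagrams" "\<nu> \<in> young_diagrams"
    "(frobenius_arms \<mu>, frobenius_arms (prod.swap ` \<mu>)) = (frobenius_arms \<nu>, frobenius_arms (prod.swap ` \<nu>))"
  have upper: "(i, j) \<in> \<mu> \<longleftrightarrow> (i, j) \<in> \<nu>"
    if "\<mu> \<in> young_diagrams" "\<nu> \<in> young_diagrams" "frobenius_arms \<mu> = frobenius_arms \<nu>" "i \<le> j"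
    for \<mu> \<nu> i j
  proof (cases "1 \<le> i")
    case True
    then show ?thesis
      using mem_young_diagram_iff_frobenius_arms[of _ i "j - i"] that by simp
  next
    case False
    then show ?thesis
      using young_diagram_pos[OF that(1)] young_diagram_pos[OF that(2)] by blast
  qed
  have "(i, j) \<in> \<mu> \<longleftrightarrow> (i, j) \<in> \<nu>" for i j
  proof (cases "i \<le> j")
    case True
    then show ?thesis
      using upper[OF *(1,2)] * by simp
  next
    case False
    have "(j, i) \<in> prod.swap ` \<mu> \<longleftrightarrow> (j, i) \<in> prod.swap ` \<nu>"
      using upper[OF swap_young_diagram[OF *(1)] swap_young_diagram[OF *(2)], of j i] * False by simp
    then show ?thesis
      by (force simp: image_iff)
  qed
  then show "\<mu> = \<nu>" by auto
qed

lemma content_product_upper: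
  assumes \<nu>: "\<nu> \<in> young_diagrams"
  shows "content_product f {(i, j) \<in> \<nu>. i \<le> j} = (\<Prod>i\<in>diagonal \<nu>. \<Prod>c = 0..arm \<nu> i. f (int c))"
    and "content_product f {(i, j) \<in> \<nu>. i < j} = (\<Prod>i\<in>diagonal \<nu>. \<Prod>c = 1..arm \<nu> i. f (int c))"
proof -
  have "{(i, j) \<in> \<nu>. i \<le> j} = (SIGMA i:diagonal \<nu>. {i..i + arm \<nu> i})"
    "{(i, j) \<in> \<nu>. i < j} = (SIGMA i:diagonal \<nu>. {Suc i..i + arm \<nu> i})"
    by (auto simp: mem_young_diagram_iff_arm[OF \<nu>])
  moreover have "(\<Prod>j = i..i + a. f (int j - int i)) = (\<Prod>c = 0..a. f (int c))"
    "(\<Prod>j = Suc i..i + a. f (int j - int i)) = (\<Prod>c = 1..a. f (int c))" for i a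
    using prod.shift_bounds_cl_nat_ivl[of "\<lambda>j. f (int j - int i)" 0 i a]
      prod.shift_bounds_cl_nat_ivl[of "\<lambda>j. f (int j - int i)" 1 i a] by (simp_all add: add.commute)
  ultimately show "content_product f {(i, j) \<in> \<nu>. i \<le> j} = (\<Prod>i\<in>diagonal \<nu>. \<Prod>c = 0..arm \<nu> i. f (int c))"
    "content_product f {(i, j) \<in> \<nu>. i < j} = (\<Prod>i\<in>diagonal \<nu>. \<Prod>c = 1..arm \<nu> i. f (int c))"
    unfolding content_product_def using finite_diagonal[OF \<nu>] by (simp_all add: prod.Sigma[symmetric])
qed

lemma content_product_swap:
  "content_product f (prod.swap ` \<nu>) = content_product (\<lambda>c. f (- c)) \<nu>"
  unfolding content_product_def
  by (subst prod.reindex) (auto intro!: inj_onI prod.cong)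

text \<open>
  Boxes on or above the diagonal are grouped by rows, the others by columns. The diagonal boxes
  are assigned to the arms.
\<close>

lemma content_product_frobenius:
  assumes \<nu>: "\<nu> \<in> young_diagrams"
  shows "content_product f \<nu> =
    (\<Prod>x\<in>frobenius_arms \<nu>. \<Prod>c = 0..x. f (int c)) *
    (\<Prod>y\<in>frobenius_arms (prod.swap ` \<nu>). \<Prod>c = 1..y. f (- int c))"
proof -
  have fin: "finite \<nu>"
    using \<nu> by (rule finite_young_diagram)
  have \<nu>': "prod.swap ` \<nu> \<in> young_diagrams"
    using \<nu> by (rule swap_young_diagram)
  have split: "\<nu> = {(i, j) \<in> \<nu>. i \<le> j} \<union> {(i, j) \<in> \<nu>. j < i}"
    by auto
  have "content_product f \<nu> =
      content_product f {(i, j) \<in> \<nu>. i \<le> j} * content_product f {(i, j) \<in> \<nu>. j < i}"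
    unfolding content_product_def
    by (subst split, rule prod.union_disjoint) (auto intro: finite_subset[OF _ fin])
  also have "{(i, j) \<in> \<nu>. j < i} = prod.swap ` {(i, j) \<in> prod.swap ` \<nu>. i < j}"
    unfolding set_eq_iff split_paired_All pair_in_swap_image by simp
  also have "content_product f (prod.swap ` {(i, j) \<in> prod.swap ` \<nu>. i < j}) =
      (\<Prod>i\<in>diagonal (prod.swap ` \<nu>). \<Prod>c = 1..arm (prod.swap ` \<nu>) i. f (- int c))"
    unfolding content_product_swap content_product_upper(2)[OF \<nu>'] ..
  finally show ?thesis
    unfolding content_product_upper(1)[OF \<nu>] frobenius_arms_def
    by (simp add: prod.reindex[OF inj_on_arm[OF \<nu>]] prod.reindex[OF inj_on_arm[OF \<nu>']])
qed

text \<open>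
  Expanding \<open>\<Prod>x\<in>U. 1 + \<theta> x\<close> gives the sum over subsets.
\<close>

lemma sum_Pow_prod_le_exp:
  fixes \<theta> :: "nat \<Rightarrow> real"
  assumes "summable \<theta>" "\<And>x. 0 \<le> \<theta> x" "finite U"
  shows "(\<Sum>X\<in>Pow U. \<Prod>x\<in>X. \<theta> x) \<le> exp (suminf \<theta>)"
proof -
  have "(\<Sum>X\<in>Pow U. \<Prod>x\<in>X. \<theta> x) = (\<Prod>x\<in>U. \<theta> x + 1)"
    using prod_add[OF assms(3), of \<theta> "\<lambda>_. 1"] by simp
  also have "\<dots> \<le> (\<Prod>x\<in>U. exp (\<theta> x))"
    using assms(2) by (intro prod_mono) (auto simp: add.commute exp_ge_add_one_self add_nonneg_nonneg)
  also have "\<dots> = exp (sum \<theta> U)"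
    by (simp add: exp_sum assms(3))
  also have "\<dots> \<le> exp (suminf \<theta>)"
    using sum_le_suminf[OF assms(1,3)] assms(2) by simp
  finally show ?thesis .
qed

text \<open>
  The Frobenius coordinates embed the diagrams into pairs of finite sets, and on all such pairs
  the sum factorises.
\<close>

lemma content_product_summable:
  fixes f :: "int \<Rightarrow> real"
  assumes nonneg: "\<And>c. 0 \<le> f c"
    and sum1: "summable (\<lambda>x. \<Prod>c = 0..x. f (int c))"
    and sum2: "summable (\<lambda>y. \<Prod>c = 1..y. f (- int c))"
  shows "content_product f summable_on young_diagrams"
proof (rule nonneg_bdd_above_summable_on)
  show "0 \<le> content_product f \<nu>" if "\<nu> \<in> young_diagrams" for \<nu>
    unfolding content_product_def by (rule prod_nonneg) (auto simp: nonneg)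
  define \<theta> where "\<theta> = (\<lambda>x. \<Prod>c = 0..x. f (int c))"
  define \<theta>' where "\<theta>' = (\<lambda>y. \<Prod>c = 1..y. f (- int c))"
  have pos: "0 \<le> \<theta> x" "0 \<le> \<theta>' x" for x
    unfolding \<theta>_def \<theta>'_def by (auto intro: prod_nonneg simp: nonneg)
  show "bdd_above (sum (content_product f) ` {S. S \<subseteq> young_diagrams \<and> finite S})"
  proof (rule bdd_aboveI2)
    fix S assume "S \<in> {S. S \<subseteq> young_diagrams \<and> finite S}"
    then have S: "S \<subseteq> young_diagrams" "finite S" by auto
    let ?\<Phi> = "\<lambda>\<nu>. (frobenius_arms \<nu>, frobenius_arms (prod.swap ` \<nu>))"
    define U where "U = (\<Union>\<nu>\<in>S. frobenius_arms \<nu> \<union> frobenius_arms (prod.swap ` \<nu>))"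
    have finU: "finite U"
      using S swap_young_diagram unfolding U_def frobenius_arms_def by (auto intro!: finite_diagonal)
    have "sum (content_product f) S =
        (\<Sum>\<nu>\<in>S. (\<lambda>(X, Y). (\<Prod>x\<in>X. \<theta> x) * (\<Prod>y\<in>Y. \<theta>' y)) (?\<Phi> \<nu>))"
      using S by (intro sum.cong refl) (auto simp: content_product_frobenius \<theta>_def \<theta>'_def)
    also have "\<dots> = (\<Sum>(X, Y)\<in>?\<Phi> ` S. (\<Prod>x\<in>X. \<theta> x) * (\<Prod>y\<in>Y. \<theta>' y))"
      by (subst sum.reindex[OF inj_on_subset[OF inj_on_frobenius S(1)]]) (simp add: o_def)
    also have "\<dots> \<le> (\<Sum>(X, Y)\<in>Pow U \<times> Pow U. (\<Prod>x\<in>X. \<theta> x) * (\<Prod>y\<in>Y. \<theta>' y))"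
      using finU by (intro sum_mono2) (auto simp: U_def intro!: mult_nonneg_nonneg prod_nonneg pos)
    also have "\<dots> = (\<Sum>X\<in>Pow U. \<Prod>x\<in>X. \<theta> x) * (\<Sum>Y\<in>Pow U. \<Prod>y\<in>Y. \<theta>' y)"
      by (simp add: sum_product sum.cartesian_product)
    also have "\<dots> \<le> exp (suminf \<theta>) * exp (suminf \<theta>')"
      using sum1 sum2 finU pos
      by (intro mult_mono sum_Pow_prod_le_exp) (auto simp: \<theta>_def \<theta>'_def intro!: sum_nonneg prod_nonneg nonneg)
    finally show "sum (content_product f) S \<le> exp (suminf \<theta>) * exp (suminf \<theta>')" .
  qed
qed

section \<open>The limit of the normalising constant\<close>

text \<open>
  The factor of index \<open>i\<close> of the normalising constant is the value at \<open>x = w' + i\<close>.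
\<close>

definition gamma_cross_ratio :: "complex \<Rightarrow> complex \<Rightarrow> real \<Rightarrow> complex" where
  "gamma_cross_ratio z z' x =
     Gamma (z + of_real x) * Gamma (z' + of_real x) / (Gamma (z + z' + of_real x) * Gamma (of_real x))"

text \<open>
  This restates Euler's limit formula for the Gamma function.
\<close>

lemma Gamma_shift_asymptotics:
  assumes "u \<notin> \<int>\<^sub>\<le>\<^sub>0"
  shows "(\<lambda>n. Gamma (u + of_nat (Suc n)) / (fact n * exp (u * of_real (ln (of_nat n))))) \<longlonglongrightarrow> (1 :: complex)"
proof -
  have \<Gamma>: "Gamma u \<noteq> 0"
    using assms by (simp add: Gamma_eq_zero_iff)
  have "(\<lambda>n. Gamma u / Gamma_series u n) \<longlonglongrightarrow> Gamma u / Gamma u"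
    using \<Gamma> by (intro tendsto_intros)
  moreover have "Gamma u / Gamma_series u n =
      Gamma (u + of_nat (Suc n)) / (fact n * exp (u * of_real (ln (of_nat n))))" for n
    using pochhammer_Gamma[OF assms, of "Suc n"] \<Gamma> by (simp add: Gamma_series_def field_simps)
  ultimately show ?thesis
    using \<Gamma> by simp
qed

text \<open>
  The leading factors \<open>fact n * exp (u * ln n)\<close> of the four Gamma values cancel, since both pairs
  of arguments have the same sum.
\<close>

lemma gamma_cross_ratio_tendsto_1:
  assumes "norm z + norm z' < x"
  shows "(\<lambda>n. gamma_cross_ratio z z' (x + real n)) \<longlonglongrightarrow> 1"
proof -
  have bounds: "\<bar>Re z\<bar> + \<bar>Re z'\<bar> < x"
    using assms abs_Re_le_cmod[of z] abs_Re_le_cmod[of z'] by linarith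
  have pos: "u \<notin> \<int>\<^sub>\<le>\<^sub>0" if "0 < Re u" for u :: complex
    using that by (auto elim!: nonpos_Ints_cases)
  define E where "E = (\<lambda>u n. Gamma (u + of_nat (Suc n)) / (fact n * exp (u * of_real (ln (of_nat n)))) :: complex)"
  have E: "E u \<longlonglongrightarrow> 1" if "0 < Re u" for u
    unfolding E_def using Gamma_shift_asymptotics[OF pos[OF that]] .
  have "(\<lambda>n. E (z + of_real x) n * E (z' + of_real x) n / (E (z + z' + of_real x) n * E (of_real x) n))
      \<longlonglongrightarrow> 1 * 1 / (1 * 1)"
    using bounds by (intro tendsto_intros E) auto
  moreover have "E (z + of_real x) n * E (z' + of_real x) n / (E (z + z' + of_real x) n * E (of_real x) n) =
      gamma_cross_ratio z z' (x + real (Suc n))" for n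
  proof -
    define l where "l = complex_of_real (ln (of_nat n))"
    have "exp ((z + of_real x) * l) * exp ((z' + of_real x) * l) =
        exp ((z + z' + of_real x) * l) * exp (of_real x * l)"
      by (simp add: exp_add[symmetric] algebra_simps)
    then show ?thesis
      unfolding E_def gamma_cross_ratio_def l_def[symmetric]
      by (simp add: divide_simps add.assoc)
  qed
  ultimately have "(\<lambda>n. gamma_cross_ratio z z' (x + real (Suc n))) \<longlonglongrightarrow> 1"
    by simp
  then show ?thesis
    by (rule LIMSEQ_imp_Suc)
qed

lemma gamma_cross_ratio_pos:
  assumes "admissible z z'" "norm z + norm z' + 1 \<le> x"
  shows "gamma_cross_ratio z z' x = of_real (Re (gamma_cross_ratio z z' x))"
    and "0 < Re (gamma_cross_ratio z z' x)"
proof -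
  \<comment> \<open>Positivity is inherited from the one-factor normalising constant with parameter \<open>x - 1\<close>.\<close>
  have "zw_prefactor z z' (x - 1) 1 = gamma_cross_ratio z z' x"
    by (simp add: zw_prefactor_def gamma_cross_ratio_def add.assoc)
  then have nonneg: "gamma_cross_ratio z z' x \<in> \<real>\<^sub>\<ge>\<^sub>0"
    using zw_prefactor_nonneg[OF assms(1), of "x - 1" 1] assms(2) by simp
  then show real: "gamma_cross_ratio z z' x = of_real (Re (gamma_cross_ratio z z' x))"
    by (auto elim!: nonneg_Reals_cases)
  have bounds: "\<bar>Re z\<bar> + \<bar>Re z'\<bar> < x"
    using assms(2) abs_Re_le_cmod[of z] abs_Re_le_cmod[of z'] by linarith
  have "Gamma u \<noteq> 0" if "0 < Re u" for u :: complex
    using that by (auto simp: Gamma_eq_zero_iff elim!: nonpos_Ints_cases)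
  then have "gamma_cross_ratio z z' x \<noteq> 0"
    unfolding gamma_cross_ratio_def using bounds by simp
  then show "0 < Re (gamma_cross_ratio z z' x)"
    using nonneg real by (metis complex_nonneg_Reals_iff less_le of_real_0)
qed

lemma gamma_cross_ratio_step:
  assumes "norm z + norm z' < x"
  shows "gamma_cross_ratio z z' (x + 1) * ((z + z' + of_real x) * of_real x) =
    gamma_cross_ratio z z' x * ((z + of_real x) * (z' + of_real x))"
proof -
  have bounds: "\<bar>Re z\<bar> + \<bar>Re z'\<bar> < x"
    using assms abs_Re_le_cmod[of z] abs_Re_le_cmod[of z'] by linarith
  have ni: "u \<notin> \<int>\<^sub>\<le>\<^sub>0" and nz: "u \<noteq> 0" if "0 < Re u" for u :: complex
    using that by (auto elim!: nonpos_Ints_cases)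
  have G: "Gamma (u + 1) = u * Gamma u" "Gamma u \<noteq> 0" if "0 < Re u" for u :: complex
    using Gamma_plus1[OF ni[OF that]] ni[OF that] by (simp_all add: Gamma_eq_zero_iff)
  define a b d e where abde: "a = z + of_real x" "b = z' + of_real x"
    "d = z + z' + of_real x" "e = complex_of_real x"
  have pos: "0 < Re a" "0 < Re b" "0 < Re d" "0 < Re e"
    using bounds by (auto simp: abde)
  have \<rho>1: "gamma_cross_ratio z z' (x + 1) = Gamma (a + 1) * Gamma (b + 1) / (Gamma (d + 1) * Gamma (e + 1))"
    by (simp add: gamma_cross_ratio_def abde add.assoc)
  have \<rho>0: "gamma_cross_ratio z z' x = Gamma a * Gamma b / (Gamma d * Gamma e)"
    by (simp add: gamma_cross_ratio_def abde)
  have "gamma_cross_ratio z z' (x + 1) * (d * e) = gamma_cross_ratio z z' x * (a * b)"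
    unfolding \<rho>0 \<rho>1 using G[OF pos(1)] G[OF pos(2)] G[OF pos(3)] G[OF pos(4)] nz[OF pos(3)] nz[OF pos(4)]
    by (simp add: divide_simps)
  then show ?thesis
    unfolding abde .
qed

text \<open>
  By the functional equation of Gamma, the difference of the logarithm at \<open>x\<close> and \<open>x + 1\<close> is
  elementary and close to \<open>- c * (1 / x - 1 / (x + 1))\<close>. The logarithm tends to 0 along
  \<open>x + n\<close>, so summing these differences recovers it.
\<close>

lemma ln_gamma_cross_ratio_asymptotics:
  assumes adm: "admissible z z'" and "\<epsilon> > 0"
  defines "c \<equiv> Re (z * z')"
  shows "\<forall>\<^sub>F x in at_top. \<bar>ln (Re (gamma_cross_ratio z z' x)) + c / x\<bar> \<le> \<epsilon> / x"
proof -
  define s where "s = Re (z + z')"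
  define L where "L = (\<lambda>x. ln (Re (gamma_cross_ratio z z' x)))"
  define h where "h = (\<lambda>x. ln ((x\<^sup>2 + s * x) / (x\<^sup>2 + s * x + c)))"
  have real: "z * z' = of_real c" "z + z' = of_real s"
    using admissible_cases[OF adm] by (auto simp: c_def s_def complex_is_Real_iff complex_eq_iff)
  \<comment> \<open>The comparison function telescopes, which is why the error is measured against it.\<close>
  have "((\<lambda>x. h x / (1 / x - 1 / (x + 1))) \<longlongrightarrow> - c) at_top"
    unfolding h_def by real_asymp
  then have "\<forall>\<^sub>F x in at_top. dist (h x / (1 / x - 1 / (x + 1))) (- c) < \<epsilon>"
    using \<open>\<epsilon> > 0\<close> by (rule tendstoD)
  moreover have "\<forall>\<^sub>F x in at_top. 0 < x\<^sup>2 + s * x + c"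
    by real_asymp
  ultimately have "\<forall>\<^sub>F x in at_top. norm z + norm z' + 1 \<le> x \<and> 0 < x\<^sup>2 + s * x + c \<and>
      dist (h x / (1 / x - 1 / (x + 1))) (- c) < \<epsilon>"
    using eventually_ge_at_top[of "norm z + norm z' + 1"] by eventually_elim auto
  then obtain X where X: "norm z + norm z' + 1 \<le> x" "0 < x\<^sup>2 + s * x + c"
    "dist (h x / (1 / x - 1 / (x + 1))) (- c) < \<epsilon>" if "x \<ge> X" for x
    unfolding eventually_at_top_linorder by blast
  have step: "\<bar>L x - L (x + 1) + c * (1 / x - 1 / (x + 1))\<bar> \<le> \<epsilon> * (1 / x - 1 / (x + 1))"
    if x: "x \<ge> X" for x
  proof -
    have x0: "x > 0" "norm z + norm z' < x"
      using X(1)[OF x] norm_ge_zero[of z] norm_ge_zero[of z'] by linarith+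
    have "\<bar>s\<bar> < x"
      using x0(2) abs_Re_le_cmod[of "z + z'"] norm_triangle_ineq[of z z'] by (simp add: s_def)
    then have sx: "0 < x\<^sup>2 + s * x"
      using x0(1) by (simp add: power2_eq_square distrib_right[symmetric])
    note \<rho> = gamma_cross_ratio_pos[OF adm X(1)[OF x]]
    have \<rho>': "gamma_cross_ratio z z' (x + 1) = of_real (Re (gamma_cross_ratio z z' (x + 1)))"
      "0 < Re (gamma_cross_ratio z z' (x + 1))"
      using gamma_cross_ratio_pos[OF adm, of "x + 1"] X(1)[OF x] by simp_all
    have "(z + z' + of_real x) * of_real x = of_real (x\<^sup>2 + s * x)"
      "(z + of_real x) * (z' + of_real x) = z * z' + (z + z') * of_real x + of_real (x\<^sup>2)"
      by (simp_all add: real(2)[symmetric] power2_eq_square algebra_simps)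
    then have "gamma_cross_ratio z z' (x + 1) * of_real (x\<^sup>2 + s * x) =
        gamma_cross_ratio z z' x * of_real (x\<^sup>2 + s * x + c)"
      using gamma_cross_ratio_step[OF x0(2)] by (simp add: real[symmetric] algebra_simps)
    then have "Re (gamma_cross_ratio z z' (x + 1) * of_real (x\<^sup>2 + s * x)) =
        Re (gamma_cross_ratio z z' x * of_real (x\<^sup>2 + s * x + c))"
      by simp
    then have "Re (gamma_cross_ratio z z' (x + 1)) * (x\<^sup>2 + s * x) =
        Re (gamma_cross_ratio z z' x) * (x\<^sup>2 + s * x + c)"
      by (simp only: Re_complex_of_real Im_complex_of_real mult_zero_right diff_zero times_complex.simps)
    then have "Re (gamma_cross_ratio z z' x) =
        Re (gamma_cross_ratio z z' (x + 1)) * ((x\<^sup>2 + s * x) / (x\<^sup>2 + s * x + c))"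
      using X(2)[OF x] by (simp add: field_simps)
    then have "L x = ln (Re (gamma_cross_ratio z z' (x + 1)) * ((x\<^sup>2 + s * x) / (x\<^sup>2 + s * x + c)))"
      unfolding L_def by (rule arg_cong)
    also have "\<dots> = L (x + 1) + h x"
      unfolding L_def h_def using \<rho>'(2) sx X(2)[OF x] by (intro ln_mult_pos divide_pos_pos)
    finally have "L x = L (x + 1) + h x" .
    moreover have "\<bar>h x + c * (1 / x - 1 / (x + 1))\<bar> \<le> \<epsilon> * (1 / x - 1 / (x + 1))"
    proof -
      define D where "D = 1 / x - 1 / (x + 1)"
      have D: "0 < D"
        using x0 by (simp add: D_def frac_less2)
      then have "\<bar>h x + c * D\<bar> = \<bar>h x / D + c\<bar> * D"
        using abs_mult[of "h x / D + c" D] by (simp add: distrib_right)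
      also have "\<dots> \<le> \<epsilon> * D"
        using X(3)[OF x] D by (intro mult_right_mono) (simp_all add: D_def dist_real_def)
      finally show ?thesis
        unfolding D_def .
    qed
    ultimately show ?thesis by simp
  qed
  have telescope: "\<bar>L x - L (x + real n) + c * (1 / x - 1 / (x + real n))\<bar> \<le> \<epsilon> * (1 / x - 1 / (x + real n))"
    if x: "x \<ge> X" for x n
  proof (induction n)
    case (Suc n)
    have next_step: "\<bar>L (x + real n) - L (x + real n + 1) + c * (1 / (x + real n) - 1 / (x + real n + 1))\<bar>
        \<le> \<epsilon> * (1 / (x + real n) - 1 / (x + real n + 1))"
      using x by (intro step) simp
    have shift: "x + real (Suc n) = x + real n + 1" by simp
    show ?case
      using Suc next_step unfolding shift right_diff_distrib by linarith
  qed simp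
  have "\<bar>L x + c / x\<bar> \<le> \<epsilon> / x" if x: "x \<ge> X" for x
  proof -
    have "(\<lambda>n. L (x + real n)) \<longlonglongrightarrow> ln (Re 1)"
      unfolding L_def using X(1)[OF x] by (intro tendsto_intros gamma_cross_ratio_tendsto_1) auto
    then have L0: "(\<lambda>n. L (x + real n)) \<longlonglongrightarrow> 0" by simp
    have inv: "(\<lambda>n. 1 / (x + real n)) \<longlonglongrightarrow> 0"
      by real_asymp
    have "(\<lambda>n. \<bar>L x - L (x + real n) + c * (1 / x - 1 / (x + real n))\<bar>)
        \<longlonglongrightarrow> \<bar>L x - 0 + c * (1 / x - 0)\<bar>"
      by (intro tendsto_intros L0 inv)
    moreover have "(\<lambda>n. \<epsilon> * (1 / x - 1 / (x + real n))) \<longlonglongrightarrow> \<epsilon> * (1 / x - 0)"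
      by (intro tendsto_intros inv)
    ultimately have "\<bar>L x - 0 + c * (1 / x - 0)\<bar> \<le> \<epsilon> * (1 / x - 0)"
      using telescope[OF x] by (intro LIMSEQ_le) auto
    then show ?thesis by simp
  qed
  then show ?thesis
    unfolding L_def eventually_at_top_linorder by blast
qed

lemma sum_inverse_shift_bounds:
  assumes "w > 0"
  shows "(\<Sum>i = 1..N. 1 / (w + real i)) \<le> ln ((w + real N) / w)"
    and "ln ((w + 1 + real N) / (w + 1)) \<le> (\<Sum>i = 1..N. 1 / (w + real i))"
proof -
  have up: "1 / (y + 1) \<le> ln (y + 1) - ln y" and low: "ln (y + 1) - ln y \<le> 1 / y" if "y > 0" for y :: real
  proof -
    have "ln (y / (y + 1)) \<le> y / (y + 1) - 1"
      using that by (intro ln_le_minus_one) simp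
    then show "1 / (y + 1) \<le> ln (y + 1) - ln y"
      using that by (simp add: ln_div field_simps)
    have "ln ((y + 1) / y) \<le> (y + 1) / y - 1"
      using that by (intro ln_le_minus_one) simp
    then show "ln (y + 1) - ln y \<le> 1 / y"
      using that by (simp add: ln_div field_simps)
  qed
  show "(\<Sum>i = 1..N. 1 / (w + real i)) \<le> ln ((w + real N) / w)"
  proof (induction N)
    case (Suc N)
    then show ?case
      using up[of "w + real N"] assms by (simp add: ln_div add.assoc add.commute[of 1])
  qed (use assms in simp)
  show "ln ((w + 1 + real N) / (w + 1)) \<le> (\<Sum>i = 1..N. 1 / (w + real i))"
  proof (induction N)
    case (Suc N)
    then show ?case
      using low[of "w + 1 + real N"] assms by (simp add: ln_div algebra_simps)
  qed (use assms in simp)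
qed

text \<open>
  The logarithm of the product is \<open>- z z'\<close> times the sum of \<open>1 / (w' + i)\<close>, with an error that is
  small relative to that sum, and the sum is squeezed between logarithms tending to \<open>ln (1 + r)\<close>.
\<close>

lemma zw_prefactor_tendsto:
  fixes F :: "'i filter"
  assumes adm: "admissible z z'" and r: "r > 0"
    and w: "filterlim w at_top F" and N: "((\<lambda>t. real (N t) / w t) \<longlongrightarrow> r) F"
  shows "((\<lambda>t. zw_prefactor z z' (w t) (N t)) \<longlongrightarrow> of_real (1 + r) powr (- (z * z'))) F"
proof -
  define c where "c = Re (z * z')"
  define S where "S = (\<lambda>t. \<Sum>i = 1..N t. 1 / (w t + real i))"
  define \<Lambda> where "\<Lambda> = (\<lambda>t. \<Sum>i = 1..N t. ln (Re (gamma_cross_ratio z z' (w t + real i))))"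
  have w_ge: "\<forall>\<^sub>F t in F. a \<le> w t" for a
    using w by (simp add: filterlim_at_top)
  have w0: "((\<lambda>t. 1 / w t) \<longlongrightarrow> 0) F"
    using tendsto_inverse_0_at_top[OF w] by (simp add: divide_inverse)
  have S: "(S \<longlongrightarrow> ln (1 + r)) F"
  proof (rule tendsto_sandwich)
    show "\<forall>\<^sub>F t in F. S t \<le> ln (1 + real (N t) / w t)"
      using w_ge[of 1]
    proof eventually_elim
      case (elim t)
      then show ?case
        using sum_inverse_shift_bounds(1)[of "w t" "N t"] by (simp add: S_def add_divide_distrib)
    qed
    show "\<forall>\<^sub>F t in F. ln (1 + (real (N t) / w t) / (1 + 1 / w t)) \<le> S t"
      using w_ge[of 1]
    proof eventually_elim
      case (elim t)
      have "1 + (real (N t) / w t) / (1 + 1 / w t) = (w t + 1 + real (N t)) / (w t + 1)"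
        using elim by (simp add: field_simps)
      then show ?case
        using sum_inverse_shift_bounds(2)[of "w t" "N t"] elim by (simp add: S_def)
    qed
    show "((\<lambda>t. ln (1 + real (N t) / w t)) \<longlongrightarrow> ln (1 + r)) F"
      using r by (intro tendsto_intros N) auto
    have "((\<lambda>t. ln (1 + (real (N t) / w t) / (1 + 1 / w t))) \<longlongrightarrow> ln (1 + r / (1 + 0))) F"
      using r by (intro tendsto_intros N w0) auto
    then show "((\<lambda>t. ln (1 + (real (N t) / w t) / (1 + 1 / w t))) \<longlongrightarrow> ln (1 + r)) F"
      by simp
  qed
  have "((\<lambda>t. \<Lambda> t + c * S t) \<longlongrightarrow> 0) F"
  proof (rule tendstoI)
    fix e :: real assume e: "e > 0"
    \<comment> \<open>The bound \<open>ln (1 + r) + 1\<close> eventually exceeds \<open>S\<close>.\<close>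
    define \<epsilon> where "\<epsilon> = e / (ln (1 + r) + 1)"
    have l: "0 < ln (1 + r) + 1"
      using r by (intro add_nonneg_pos) auto
    have \<epsilon>: "\<epsilon> > 0" "\<epsilon> * (ln (1 + r) + 1) = e"
      using e l by (simp_all add: \<epsilon>_def)
    obtain X where X: "\<bar>ln (Re (gamma_cross_ratio z z' x)) + c / x\<bar> \<le> \<epsilon> / x" if "x \<ge> X" for x
      using ln_gamma_cross_ratio_asymptotics[OF adm \<epsilon>(1)]
      unfolding eventually_at_top_linorder c_def by blast
    have "\<forall>\<^sub>F t in F. S t < ln (1 + r) + 1"
      by (rule order_tendstoD(2)[OF S]) simp
    then show "\<forall>\<^sub>F t in F. dist (\<Lambda> t + c * S t) 0 < e"
      using w_ge[of X]
    proof eventually_elim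
      case (elim t)
      have "\<Lambda> t + c * S t =
          (\<Sum>i = 1..N t. ln (Re (gamma_cross_ratio z z' (w t + real i))) + c / (w t + real i))"
        by (simp add: \<Lambda>_def S_def sum.distrib sum_distrib_left)
      also have "\<bar>\<dots>\<bar> \<le> (\<Sum>i = 1..N t. \<epsilon> / (w t + real i))"
        by (rule order_trans[OF sum_abs sum_mono]) (use X elim(2) in auto)
      also have "\<dots> = \<epsilon> * S t"
        by (simp add: S_def sum_distrib_left)
      also have "\<dots> < e"
        using elim(1) \<epsilon> by (metis mult_strict_left_mono)
      finally show ?case by simp
    qed
  qed
  then have "((\<lambda>t. (\<Lambda> t + c * S t) - c * S t) \<longlongrightarrow> 0 - c * ln (1 + r)) F"
    by (intro tendsto_intros S)
  then have "((\<lambda>t. complex_of_real (exp (\<Lambda> t))) \<longlongrightarrow> of_real (exp (- c * ln (1 + r)))) F"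
    by (intro tendsto_intros) simp
  moreover have "complex_of_real (exp (- c * ln (1 + r))) = of_real (1 + r) powr (- (z * z'))"
  proof -
    have "z * z' = of_real c"
      by (simp only: c_def of_real_Re[OF admissible_cases(1)[OF adm]])
    then show ?thesis
      using powr_of_real[of "1 + r" "- c"] r by (simp add: powr_def)
  qed
  moreover have "\<forall>\<^sub>F t in F. complex_of_real (exp (\<Lambda> t)) = zw_prefactor z z' (w t) (N t)"
    using w_ge[of "norm z + norm z'"]
  proof eventually_elim
    case (elim t)
    have "complex_of_real (exp (\<Lambda> t)) =
        (\<Prod>i = 1..N t. of_real (exp (ln (Re (gamma_cross_ratio z z' (w t + real i))))))"
      by (simp add: \<Lambda>_def exp_sum)
    also have "\<dots> = (\<Prod>i = 1..N t. gamma_cross_ratio z z' (w t + real i))"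
    proof (rule prod.cong[OF refl])
      fix i assume "i \<in> {1..N t}"
      then have "norm z + norm z' + 1 \<le> w t + real i"
        using elim by simp
      note \<rho> = gamma_cross_ratio_pos[OF adm this]
      show "complex_of_real (exp (ln (Re (gamma_cross_ratio z z' (w t + real i))))) =
          gamma_cross_ratio z z' (w t + real i)"
        using \<rho>(2) by (simp flip: \<rho>(1))
    qed
    also have "\<dots> = zw_prefactor z z' (w t) (N t)"
      by (simp add: gamma_cross_ratio_def zw_prefactor_def add.assoc)
    finally show ?case .
  qed
  ultimately show ?thesis
    using Lim_transform_eventually by fastforce
qed

section \<open>The measures as densities on diagrams\<close>

text \<open>
  The part of the masses that is common to the z-measure and all zw-measures.
\<close>

definition diagram_weight :: "complex \<Rightarrow> complex \<Rightarrow> (nat \<times> nat) set \<Rightarrow> real" where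
  "diagram_weight z z' \<nu> = Re (diagram_pochhammer z \<nu> * diagram_pochhammer z' \<nu>) *
     (real (dim_diagram \<nu>) / fact (card \<nu>))\<^sup>2"

text \<open>
  The part of the zw-mass that depends on \<open>N\<close> and \<open>w\<close>, apart from the normalising constant. It
  vanishes on diagrams with more than \<open>N\<close> rows, because of the box \<open>(N + 1, 1)\<close>, so the same formula
  describes the zw-masses on all diagrams.
\<close>

definition content_ratio :: "nat \<Rightarrow> real \<Rightarrow> (nat \<times> nat) set \<Rightarrow> real" where
  "content_ratio N w \<nu> = content_product (\<lambda>c. real N + of_int c) \<nu> /
     content_product (\<lambda>c. w + real N + of_int c) \<nu>"

lemma prod_Gamma_quotient_rows:
  assumes "x \<ge> 0" "\<forall>i\<in>{1..N}. 0 \<le> \<mu> i"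
  shows "(\<Prod>i = 1..N. Gamma (x + real N + 1 + real_of_int (\<mu> i) - real i) / Gamma (x + real N + 1 - real i)) =
    content_product (\<lambda>c. x + real N + of_int c) (diagram_of_signature N \<mu>)"
  unfolding content_product_rows
proof (rule prod.cong[OF refl])
  fix i assume i: "i \<in> {1..N}"
  define a where "a = x + real N + 1 - real i"
  have a: "a > 0"
    using i assms(1) by (simp add: a_def)
  have "Gamma (a + real (nat (\<mu> i))) / Gamma a = pochhammer a (nat (\<mu> i))"
    using a by (intro pochhammer_Gamma[symmetric]) (auto elim!: nonpos_Ints_cases)
  also have "\<dots> = (\<Prod>j = 0..<nat (\<mu> i). a + real j)"
    by (simp add: pochhammer_prod)
  also have "\<dots> = (\<Prod>j = Suc 0..<Suc (nat (\<mu> i)). a + real (j - 1))"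
    by (subst prod.shift_bounds_Suc_ivl) simp
  also have "\<dots> = (\<Prod>j = 1..nat (\<mu> i). x + real N + of_int (int j - int i))"
    by (rule prod.cong) (auto simp: a_def of_nat_diff)
  finally show "Gamma (x + real N + 1 + real_of_int (\<mu> i) - real i) / Gamma (x + real N + 1 - real i) =
      (\<Prod>j = 1..nat (\<mu> i). x + real N + of_int (int j - int i))"
    using assms(2) i by (simp add: a_def algebra_simps)
qed

lemma content_product_pos:
  assumes "\<nu> \<in> young_diagrams" "x \<ge> 0" "\<And>i j. (i, j) \<in> \<nu> \<Longrightarrow> i \<le> N"
  shows "0 < content_product (\<lambda>c. x + real N + of_int c) \<nu>"
  unfolding content_product_def
proof (rule prod_pos, clarify)
  fix i j assume ij: "(i, j) \<in> \<nu>"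
  have "real i \<le> real N" "1 \<le> real j"
    using assms(3)[OF ij] young_diagram_pos[OF assms(1) ij] by simp_all
  then show "0 < x + real N + of_int (int j - int i)"
    using assms(2) by simp
qed

text \<open>
  With \<open>A\<close> and \<open>B\<close> the content products for \<open>N\<close> and \<open>w + N\<close>, the Gamma quotients contribute
  \<open>1 / (A * B)\<close> and the squared dimension of the signature
  contributes \<open>A\<^sup>2\<close>, where \<open>A / B\<close> is the content ratio. The signs of \<open>z\<close> and \<open>z'\<close> change because
  the polynomials \<open>gamma_ratio\<close> run over the transposed diagram.
\<close>

lemma zw_mass_eq:
  assumes \<mu>: "\<mu> \<in> signatures N" "\<forall>i\<in>{1..N}. 0 \<le> \<mu> i" and N: "N > 0" and w: "w \<ge> 0"
  defines "\<nu> \<equiv> diagram_of_signature N \<mu>"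
  shows "zw_mass z z' w N \<mu> = zw_prefactor z z' w N *
    (diagram_pochhammer (- z) \<nu> * diagram_pochhammer (- z') \<nu>) *
    of_real ((real (dim_diagram \<nu>) / fact (card \<nu>))\<^sup>2 * content_ratio N w \<nu>)"
proof -
  define A where "A = content_product (\<lambda>c. real N + of_int c) \<nu>"
  define B where "B = content_product (\<lambda>c. w + real N + of_int c) \<nu>"
  have young: "\<nu> \<in> young_diagrams"
    unfolding \<nu>_def by (rule diagram_of_signature_young[OF \<mu>(1)])
  have rows: "i \<le> N" if "(i, j) \<in> \<nu>" for i j
    using that by (simp add: \<nu>_def diagram_of_signature_def)
  have "N \<in> {1..N}"
    using N by simp
  then have \<mu>N: "(\<mu> N < 0) = False"
    using \<mu>(2) not_less by blast
  have A: "A > 0"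
    using content_product_pos[OF young order_refl rows] by (simp add: A_def)
  have "(\<Prod>i = 1..N. (Gamma (real N + 1 - real i) * Gamma (w + real N + 1 - real i)) /
       (Gamma (real N + 1 + real_of_int (\<mu> i) - real i) * Gamma (w + real N + 1 + real_of_int (\<mu> i) - real i))) =
     inverse (\<Prod>i = 1..N. Gamma (0 + real N + 1 + real_of_int (\<mu> i) - real i) / Gamma (0 + real N + 1 - real i)) *
     inverse (\<Prod>i = 1..N. Gamma (w + real N + 1 + real_of_int (\<mu> i) - real i) / Gamma (w + real N + 1 - real i))"
    unfolding prod_inversef[symmetric] prod.distrib[symmetric] by (rule prod.cong) (simp_all add: o_def)
  also have "\<dots> = inverse A * inverse B"
    using prod_Gamma_quotient_rows[OF order_refl \<mu>(2)] prod_Gamma_quotient_rows[OF w \<mu>(2)]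
    by (simp add: A_def B_def \<nu>_def)
  finally have G: "(\<Prod>i = 1..N. (Gamma (real N + 1 - real i) * Gamma (w + real N + 1 - real i)) /
       (Gamma (real N + 1 + real_of_int (\<mu> i) - real i) * Gamma (w + real N + 1 + real_of_int (\<mu> i) - real i))) =
     inverse A * inverse B" .
  have D: "Dim_signature N \<mu> = real (dim_diagram \<nu>) / fact (card \<nu>) * A"
    using dim_diagram_eq_Dim_signature[OF \<mu>] A by (simp add: A_def \<nu>_def)
  have "(\<Prod>i = 1..N. gamma_ratio z i (\<mu> i) * gamma_ratio z' i (\<mu> i)) =
      diagram_pochhammer (- z) \<nu> * diagram_pochhammer (- z') \<nu>"
    unfolding prod.distrib prod_gamma_ratio diagram_pochhammer_uminus_mult \<nu>_def ..
  then have "zw_mass z z' w N \<mu> = zw_prefactor z z' w N *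
      (diagram_pochhammer (- z) \<nu> * diagram_pochhammer (- z') \<nu>) *
      (of_real (inverse A * inverse B) * of_real ((real (dim_diagram \<nu>) / fact (card \<nu>) * A)\<^sup>2))"
    using \<mu>N unfolding zw_mass_def zw_Pi_def G D by (simp only: if_False mult.assoc)
  also have "of_real (inverse A * inverse B) * of_real ((real (dim_diagram \<nu>) / fact (card \<nu>) * A)\<^sup>2) =
      complex_of_real ((real (dim_diagram \<nu>) / fact (card \<nu>))\<^sup>2 * content_ratio N w \<nu>)"
    unfolding of_real_mult[symmetric] content_ratio_def A_def[symmetric] B_def[symmetric]
    using A by (intro arg_cong[where f = complex_of_real]) (simp add: power2_eq_square divide_inverse)
  finally show ?thesis .
qed

lemma Re_of_real_mult_of_real: "Re (of_real k * u * of_real q) = k * Re u * q"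
  by simp

lemma Re_zw_mass_eq:
  assumes \<mu>: "\<mu> \<in> signatures N" "\<forall>i\<in>{1..N}. 0 \<le> \<mu> i" and N: "N > 0"
    and adm: "admissible z z'" and w: "norm z + norm z' \<le> w"
  defines "\<nu> \<equiv> diagram_of_signature N \<mu>"
  shows "Re (zw_mass z z' w N \<mu>) =
    Re (zw_prefactor z z' w N) * diagram_weight (- z) (- z') \<nu> * content_ratio N w \<nu>"
proof -
  have "w \<ge> 0"
    using w norm_ge_zero[of z] norm_ge_zero[of z'] by linarith
  note eq = zw_mass_eq[OF \<mu> N this, of z z', folded \<nu>_def]
  have "zw_prefactor z z' w N = of_real (Re (zw_prefactor z z' w N))"
    by (rule of_real_Re[OF nonneg_Reals_Real[OF zw_prefactor_nonneg[OF adm w]], symmetric])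
  then obtain k where k: "zw_prefactor z z' w N = of_real k" by blast
  show ?thesis
    unfolding eq k Re_of_real_mult_of_real diagram_weight_def by simp
qed

lemma diagram_weight_nonneg:
  assumes "admissible z z'" "\<nu> \<in> young_diagrams"
  shows "0 \<le> diagram_weight z z' \<nu>"
  using assms unfolding diagram_weight_def
  by (intro mult_nonneg_nonneg) (auto simp: admissible_def complex_nonneg_Reals_iff)

lemma content_ratio_eq_0:
  assumes "\<nu> \<in> young_diagrams" "(i, j) \<in> \<nu>" "N < i"
  shows "content_ratio N w \<nu> = 0"
proof -
  have "(Suc N, 1) \<in> \<nu>"
    using assms young_diagram_pos[OF assms(1,2)]
    by (intro young_diagram_downward_closed[OF assms(1,2)]) auto
  then have "content_product (\<lambda>c. real N + of_int c) \<nu> = 0"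
    unfolding content_product_def using finite_young_diagram[OF assms(1)]
    by (intro prod_zero) (auto intro!: bexI[of _ "(Suc N, 1)"])
  then show ?thesis
    by (simp add: content_ratio_def)
qed

lemma bij_betw_diagram_of_signature:
  "bij_betw (diagram_of_signature N) {\<mu> \<in> signatures N. \<forall>i\<in>{1..N}. 0 \<le> \<mu> i}
     {\<nu> \<in> young_diagrams. \<forall>(i, j)\<in>\<nu>. i \<le> N}"
  unfolding bij_betw_def
proof (intro conjI inj_on_diagram_of_signature equalityI subsetI)
  fix \<nu> assume "\<nu> \<in> diagram_of_signature N ` {\<mu> \<in> signatures N. \<forall>i\<in>{1..N}. 0 \<le> \<mu> i}"
  then obtain \<mu> where "\<mu> \<in> signatures N" "\<nu> = diagram_of_signature N \<mu>" by blast
  then show "\<nu> \<in> {\<nu> \<in> young_diagrams. \<forall>(i, j)\<in>\<nu>. i \<le> N}"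
    using diagram_of_signature_young[of \<mu> N] by (auto simp: diagram_of_signature_def)
next
  fix \<nu> assume "\<nu> \<in> {\<nu> \<in> young_diagrams. \<forall>(i, j)\<in>\<nu>. i \<le> N}"
  then have \<nu>: "\<nu> \<in> young_diagrams" and N: "\<And>i j. (i, j) \<in> \<nu> \<Longrightarrow> i \<le> N"
    by auto
  define len where "len = (\<lambda>i. card {j. (i, j) \<in> \<nu>})"
  have row: "(i, j) \<in> \<nu> \<longleftrightarrow> 0 < j \<and> j \<le> len i" for i j
  proof -
    have "finite {j. (i, j) \<in> \<nu>}"
      by (rule finite_subset[of _ "snd ` \<nu>"])
        (auto intro: rev_image_eqI finite_young_diagram[OF \<nu>])
    moreover have "{j. (i, j) \<in> \<nu>} \<subseteq> {0<..}"
      using young_diagram_pos[OF \<nu>] by force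
    moreover have "k \<in> {j. (i, j) \<in> \<nu>}" if "j \<in> {j. (i, j) \<in> \<nu>}" "0 < k" "k \<le> j" for j k
      using that young_diagram_downward_closed[OF \<nu>, of i j i k] young_diagram_pos[OF \<nu>, of i j] by simp
    ultimately have "{j. (i, j) \<in> \<nu>} = {0<..0 + len i}"
      unfolding len_def by (rule initial_segment_eq)
    from eqset_imp_iff[OF this, of j] show ?thesis
      by simp
  qed
  define \<mu> where "\<mu> = (\<lambda>i\<in>{1..N}. int (len i))"
  have "len k \<le> len i" if "1 \<le> i" "i \<le> k" for i k
  proof (cases "len k = 0")
    case False
    then have "(k, len k) \<in> \<nu>"
      using row[of k "len k"] by simp
    then have "(i, len k) \<in> \<nu>"
      using young_diagram_downward_closed[OF \<nu>, of k "len k" i "len k"] that False by simp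
    then show ?thesis
      using row by blast
  qed simp
  then have "\<mu> \<in> signatures N" "\<forall>i\<in>{1..N}. 0 \<le> \<mu> i"
    by (auto simp: signatures_def \<mu>_def)
  moreover have "diagram_of_signature N \<mu> = \<nu>"
  proof -
    have "(i, j) \<in> diagram_of_signature N \<mu> \<longleftrightarrow> (i, j) \<in> \<nu>" for i j
    proof (cases "i \<in> {1..N}")
      case True
      then show ?thesis
        unfolding row[of i j] by (auto simp: diagram_of_signature_def \<mu>_def)
    next
      case False
      then have "(i, j) \<notin> \<nu>"
        using N young_diagram_pos(1)[OF \<nu>] by force
      then show ?thesis
        using False unfolding diagram_of_signature_def by blast
    qed
    then show ?thesis
      by auto
  qed
  ultimately show "\<nu> \<in> diagram_of_signature N ` {\<mu> \<in> signatures N. \<forall>i\<in>{1..N}. 0 \<le> \<mu> i}"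
    by blast
qed

text \<open>
  Nonnegative signatures correspond to the diagrams with at most \<open>N\<close> rows. The other signatures have
  mass zero, and the density vanishes on the other diagrams.
\<close>

lemma zw_measure_young_eq_density:
  assumes adm: "admissible z z'" and w: "norm z + norm z' \<le> w" and N: "N > 0"
  shows "zw_measure_young z z' w N = density (count_space young_diagrams)
    (\<lambda>\<nu>. ennreal (Re (zw_prefactor z z' w N) * diagram_weight (- z) (- z') \<nu> * content_ratio N w \<nu>))"
    (is "_ = density _ (\<lambda>\<nu>. ennreal (?m \<nu>))")
proof (rule measure_eqI)
  show "sets (zw_measure_young z z' w N) =
      sets (density (count_space young_diagrams) (\<lambda>\<nu>. ennreal (?m \<nu>)))"
    by (simp add: zw_measure_young_def)
  fix A assume "A \<in> sets (zw_measure_young z z' w N)"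
  then have A: "A \<subseteq> young_diagrams"
    by (simp add: zw_measure_young_def)
  let ?D = "diagram_of_signature N"
  let ?B = "{\<mu> \<in> signatures N. \<forall>i\<in>{1..N}. 0 \<le> \<mu> i}"
  let ?Y = "{\<nu> \<in> young_diagrams. \<forall>(i, j)\<in>\<nu>. i \<le> N}"
  have meas: "?D \<in> measurable (zw_measure z z' w N) (count_space young_diagrams)"
    using diagram_of_signature_young by (auto simp: zw_measure_def measurable_density_eq1)
  have "emeasure (zw_measure_young z z' w N) A =
      emeasure (zw_measure z z' w N) (?D -` A \<inter> space (zw_measure z z' w N))"
    unfolding zw_measure_young_def using A by (subst emeasure_distr[OF meas]) auto
  also have "\<dots> = (\<integral>\<^sup>+\<mu>. ennreal (Re (zw_mass z z' w N \<mu>)) * indicator (?D -` A \<inter> signatures N) \<mu>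
      \<partial>count_space (signatures N))"
    unfolding zw_measure_def by (subst emeasure_density) auto
  also have "\<dots> = (\<integral>\<^sup>+\<mu>. ennreal (Re (zw_mass z z' w N \<mu>)) * indicator (?D -` A \<inter> signatures N) \<mu>
      \<partial>count_space ?B)"
  proof (rule nn_integral_count_space_eq)
    fix \<mu> assume \<mu>: "\<mu> \<in> signatures N - ?B"
    then obtain i where i: "i \<in> {1..N}" "\<mu> i < 0"
      by (auto simp: not_le)
    then have "\<mu> N < 0"
      using \<mu> signatures_antimono[of \<mu> N i N] by auto
    then show "ennreal (Re (zw_mass z z' w N \<mu>)) * indicator (?D -` A \<inter> signatures N) \<mu> = 0"
      by (simp add: zw_mass_def)
  qed auto
  also have "\<dots> = (\<integral>\<^sup>+\<mu>. ennreal (?m (?D \<mu>)) * indicator A (?D \<mu>) \<partial>count_space ?B)"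
    by (rule nn_integral_cong) (auto simp: Re_zw_mass_eq[OF _ _ N adm w] split: split_indicator)
  also have "\<dots> = (\<integral>\<^sup>+\<nu>. ennreal (?m \<nu>) * indicator A \<nu> \<partial>count_space ?Y)"
    by (rule nn_integral_bij_count_space[OF bij_betw_diagram_of_signature])
  also have "\<dots> = (\<integral>\<^sup>+\<nu>. ennreal (?m \<nu>) * indicator A \<nu> \<partial>count_space young_diagrams)"
    by (rule nn_integral_count_space_eq) (auto simp: not_le content_ratio_eq_0)
  also have "\<dots> = emeasure (density (count_space young_diagrams) (\<lambda>\<nu>. ennreal (?m \<nu>))) A"
    using A by (subst emeasure_density) auto
  finally show "emeasure (zw_measure_young z z' w N) A =
      emeasure (density (count_space young_diagrams) (\<lambda>\<nu>. ennreal (?m \<nu>))) A" .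
qed

lemma z_measure_eq_density:
  assumes adm: "admissible z z'" and r: "r > 0"
  shows "z_measure z z' r = density (count_space young_diagrams)
    (\<lambda>\<nu>. ennreal ((1 + r) powr (- Re (z * z')) * diagram_weight z z' \<nu> * (r / (1 + r)) ^ card \<nu>))"
proof -
  define c where "c = Re (z * z')"
  have "z * z' = of_real c"
    by (simp only: c_def of_real_Re[OF admissible_cases(1)[OF adm]])
  then have "of_real (1 + r) powr (- (z * z')) = complex_of_real ((1 + r) powr (- c))"
    using powr_of_real[of "1 + r" "- c"] r by simp
  then have mass: "z_mass z z' r \<nu> = of_real ((1 + r) powr (- c)) *
      (diagram_pochhammer z \<nu> * diagram_pochhammer z' \<nu>) *
      of_real ((r / (1 + r)) ^ card \<nu> * (real (dim_diagram \<nu>) / fact (card \<nu>))\<^sup>2)" for \<nu>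
    unfolding z_mass_def by (simp only: mult.assoc)
  have "Re (z_mass z z' r \<nu>) = (1 + r) powr (- c) * diagram_weight z z' \<nu> * (r / (1 + r)) ^ card \<nu>" for \<nu>
    unfolding mass Re_of_real_mult_of_real diagram_weight_def by (simp only: mult_ac)
  then show ?thesis
    unfolding z_measure_def c_def by simp
qed

section \<open>Sums against bounded functions and dominated convergence\<close>

lemma finite_measure_density_count_space:
  assumes "m summable_on A" "\<And>x. x \<in> A \<Longrightarrow> 0 \<le> m x"
  shows "finite_measure (density (count_space A) (\<lambda>x. ennreal (m x)))"
proof
  have "(\<lambda>x. norm (m x)) summable_on A"
    using assms by (subst summable_on_cong[where g = m]) auto
  then have "integrable (count_space A) m"
    using abs_summable_equivalent[of m A] by (simp add: abs_summable_on_def)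
  then have "(\<integral>\<^sup>+x. ennreal (m x) \<partial>count_space A) < \<infinity>"
    using assms(2) by (subst nn_integral_eq_integral) auto
  moreover have "emeasure (density (count_space A) (\<lambda>x. ennreal (m x))) A =
      (\<integral>\<^sup>+x. ennreal (m x) \<partial>count_space A)"
    by (subst emeasure_density) (auto intro!: nn_integral_cong)
  ultimately show "emeasure (density (count_space A) (\<lambda>x. ennreal (m x)))
      (space (density (count_space A) (\<lambda>x. ennreal (m x)))) \<noteq> \<infinity>"
    by simp
qed

lemma integral_density_count_space:
  fixes f :: "'a \<Rightarrow> real"
  assumes m: "m summable_on A" "\<And>x. x \<in> A \<Longrightarrow> 0 \<le> m x" and f: "\<And>x. x \<in> A \<Longrightarrow> \<bar>f x\<bar> \<le> b"
  shows "integral\<^sup>L (density (count_space A) (\<lambda>x. ennreal (m x))) f = (\<Sum>\<^sub>\<infinity>x\<in>A. m x * f x)"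
proof -
  have "(\<lambda>x. norm (m x * f x)) summable_on A"
  proof (rule summable_on_comparison_test)
    show "(\<lambda>x. m x * b) summable_on A"
      using m(1) by (rule summable_on_cmult_left)
    show "norm (m x * f x) \<le> m x * b" if "x \<in> A" for x
      using m(2)[OF that] f[OF that] by (simp add: abs_mult mult_left_mono)
  qed simp
  then have "Infinite_Set_Sum.abs_summable_on (\<lambda>x. m x * f x) A"
    using abs_summable_equivalent[of "\<lambda>x. m x * f x" A] by simp
  then have "infsetsum (\<lambda>x. m x * f x) A = (\<Sum>\<^sub>\<infinity>x\<in>A. m x * f x)"
    by (rule infsetsum_infsum)
  moreover have "integral\<^sup>L (density (count_space A) (\<lambda>x. ennreal (m x))) f = infsetsum (\<lambda>x. m x * f x) A"
    unfolding infsetsum_def using m(2) by (subst integral_density) (auto simp: AE_count_space)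
  ultimately show ?thesis by simp
qed

text \<open>
  Dominated convergence for sums along an arbitrary filter, which need not have a countable base.
  The bound on the limit is a separate assumption since the filter may be trivial.
\<close>

lemma tannery_summable_on:
  fixes f :: "'t \<Rightarrow> 'a \<Rightarrow> real"
  assumes g: "g summable_on A"
    and bound: "\<forall>\<^sub>F t in F. \<forall>x\<in>A. \<bar>f t x\<bar> \<le> g x" "\<And>x. x \<in> A \<Longrightarrow> \<bar>h x\<bar> \<le> g x"
    and lim: "\<And>x. x \<in> A \<Longrightarrow> ((\<lambda>t. f t x) \<longlongrightarrow> h x) F"
  shows "((\<lambda>t. \<Sum>\<^sub>\<infinity>x\<in>A. f t x) \<longlongrightarrow> (\<Sum>\<^sub>\<infinity>x\<in>A. h x)) F"
proof (rule tendstoI)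
  fix e :: real assume e: "e > 0"
  have sub: "u summable_on B" if "\<And>x. x \<in> A \<Longrightarrow> \<bar>u x\<bar> \<le> g x" "B \<subseteq> A" for u B
  proof -
    have "(\<lambda>x. norm (u x)) summable_on A"
      by (rule summable_on_comparison_test[OF g]) (use that in auto)
    then show ?thesis
      using abs_summable_summable summable_on_subset_banach that(2) by blast
  qed
  \<comment> \<open>Outside the finite set \<open>S\<close>, each of the two sums contributes at most \<open>e / 4\<close>.\<close>
  have "\<forall>\<^sub>F S in finite_subsets_at_top A. dist (sum g S) (infsum g A) < e / 4"
    using e by (intro tendstoD[OF infsum_tendsto[OF g]]) simp
  then obtain S where S: "finite S" "S \<subseteq> A" "dist (sum g S) (infsum g A) < e / 4"
    unfolding eventually_finite_subsets_at_top by blast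
  have split: "infsum u A = sum u S + infsum u (A - S)" if "\<And>x. x \<in> A \<Longrightarrow> \<bar>u x\<bar> \<le> g x" for u
    using infsum_Un_disjoint[of u S "A - S"] sub[OF that, of "A - S"] sub[OF that, of S] S
    by (simp add: Un_absorb1 Int_Diff)
  have g_nonneg: "0 \<le> g x" if "x \<in> A" for x
    using bound(2)[OF that] by linarith
  have tail: "\<bar>infsum u (A - S)\<bar> \<le> e / 4" if u: "\<And>x. x \<in> A \<Longrightarrow> \<bar>u x\<bar> \<le> g x" for u
  proof -
    have "infsum u (A - S) \<le> infsum g (A - S)" "infsum (\<lambda>x. - u x) (A - S) \<le> infsum g (A - S)"
      using u g_nonneg by (intro infsum_mono sub; force)+
    moreover have "infsum g (A - S) < e / 4"
      using S(3) split[of g] g_nonneg by (simp add: dist_real_def)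
    ultimately show ?thesis
      by (simp add: infsum_uminus)
  qed
  have "((\<lambda>t. \<Sum>x\<in>S. f t x) \<longlongrightarrow> (\<Sum>x\<in>S. h x)) F"
    using S(2) by (intro tendsto_sum lim) auto
  then have "\<forall>\<^sub>F t in F. dist (\<Sum>x\<in>S. f t x) (\<Sum>x\<in>S. h x) < e / 2"
    using e by (intro tendstoD) auto
  then show "\<forall>\<^sub>F t in F. dist (\<Sum>\<^sub>\<infinity>x\<in>A. f t x) (\<Sum>\<^sub>\<infinity>x\<in>A. h x) < e"
    using bound(1)
  proof eventually_elim
    case (elim t)
    have "\<bar>infsum (f t) (A - S)\<bar> \<le> e / 4" "\<bar>infsum h (A - S)\<bar> \<le> e / 4"
      using elim(2) bound(2) by (intro tail; blast)+
    moreover have "infsum (f t) A = sum (f t) S + infsum (f t) (A - S)"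
      "infsum h A = sum h S + infsum h (A - S)"
      using elim(2) bound(2) by (intro split; blast)+
    ultimately show ?case
      using elim(1) e unfolding dist_real_def by linarith
  qed
qed

section \<open>The dominating function\<close>

text \<open>
  The value of \<open>(n + a) / (n + w + a)\<close> for \<open>w = W\<close> and \<open>n = R * W\<close>.
\<close>

definition ratio_bound :: "real \<Rightarrow> real \<Rightarrow> real \<Rightarrow> real" where
  "ratio_bound R W a = (R * W + a) / ((R + 1) * W + a)"

text \<open>
  The quotient increases with \<open>c\<close> and \<open>n\<close>, and along \<open>n = R * w\<close> it decreases in \<open>w\<close> when the content
  is nonnegative. Hence the worst case is \<open>c = \<bar>c\<bar>\<close>, \<open>n = R * w\<close>, \<open>w = W\<close>.
\<close>

lemma ratio_bound_ge:
  assumes pos: "R > 0" "W > 0" and w: "W \<le> w" "n \<le> R * w" and x: "0 < n + c"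
  shows "(n + c) / (w + n + c) \<le> ratio_bound R W \<bar>c\<bar>"
proof -
  define a where "a = \<bar>c\<bar>"
  have mono: "x / (v + x) \<le> y / (v + y)" if "0 \<le> x" "x \<le> y" "0 < v" for x y v :: real
    using that by (simp add: divide_simps) (simp add: algebra_simps)
  have "n + c \<le> R * w + a"
    using w(2) by (simp add: a_def)
  then have "(n + c) / (w + (n + c)) \<le> (R * w + a) / (w + (R * w + a))"
    using x pos w by (intro mono) auto
  also have "\<dots> \<le> (R * W + a) / (W + (R * W + a))"
  proof -
    have "0 < R * W + a" "0 < R * w + a"
      using pos w by (auto simp: a_def intro!: add_pos_nonneg)
    moreover have "W * a \<le> w * a"
      using w(1) by (intro mult_right_mono) (auto simp: a_def)
    ultimately show ?thesis
      using pos w(1) by (simp add: divide_simps) (simp add: algebra_simps)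
  qed
  finally show ?thesis
    unfolding ratio_bound_def a_def by (simp add: algebra_simps)
qed

lemma ratio_bound_nonneg: "R > 0 \<Longrightarrow> W > 0 \<Longrightarrow> 0 \<le> a \<Longrightarrow> 0 \<le> ratio_bound R W a"
  unfolding ratio_bound_def by (intro divide_nonneg_nonneg add_nonneg_nonneg mult_nonneg_nonneg) auto

lemma power_le_ratio_bound:
  assumes "R > 0" "W > 0" "0 < r" "r \<le> R"
  shows "(r / (1 + r)) ^ card \<nu> \<le> content_product (\<lambda>c. ratio_bound R W \<bar>of_int c\<bar>) \<nu>"
proof -
  have "r / (1 + r) \<le> ratio_bound R W a" if "0 \<le> a" for a
  proof -
    have "r / (1 + r) \<le> R / (1 + R)"
      using assms by (simp add: divide_simps) (simp add: algebra_simps)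
    also have "\<dots> \<le> ratio_bound R W a"
      using assms that unfolding ratio_bound_def
      by (simp add: divide_simps add_pos_nonneg) (simp add: algebra_simps)
    finally show ?thesis .
  qed
  then have "(\<Prod>b\<in>\<nu>. r / (1 + r)) \<le> content_product (\<lambda>c. ratio_bound R W \<bar>of_int c\<bar>) \<nu>"
    unfolding content_product_def using assms by (intro prod_mono) auto
  then show ?thesis by simp
qed

lemma content_ratio_bounds:
  assumes \<nu>: "\<nu> \<in> young_diagrams" and pos: "R > 0" "W > 0" and w: "W \<le> w" "real N \<le> R * w"
  shows "0 \<le> content_ratio N w \<nu>"
    and "content_ratio N w \<nu> \<le> content_product (\<lambda>c. ratio_bound R W \<bar>of_int c\<bar>) \<nu>"
proof -
  have nonneg: "0 \<le> content_product (\<lambda>c. ratio_bound R W \<bar>of_int c\<bar>) \<nu>"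
    unfolding content_product_def by (intro prod_nonneg) (auto intro!: ratio_bound_nonneg pos)
  have "0 \<le> content_ratio N w \<nu> \<and>
      content_ratio N w \<nu> \<le> content_product (\<lambda>c. ratio_bound R W \<bar>of_int c\<bar>) \<nu>"
  proof (cases "\<exists>(i, j)\<in>\<nu>. N < i")
    case True
    then show ?thesis
      using content_ratio_eq_0[OF \<nu>] nonneg by auto
  next
    case False
    have pos': "0 < real N + of_int (int j - int i)" if "(i, j) \<in> \<nu>" for i j
    proof -
      have "real i \<le> real N" "1 \<le> real j"
        using False that young_diagram_pos[OF \<nu> that] by force+
      then show ?thesis by simp
    qed
    have ratio: "content_ratio N w \<nu> =
        (\<Prod>(i, j)\<in>\<nu>. (real N + of_int (int j - int i)) / (w + real N + of_int (int j - int i)))"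
      unfolding content_ratio_def content_product_def prod_dividef[symmetric] by (simp add: split_def)
    have "0 \<le> (real N + of_int (int j - int i)) / (w + real N + of_int (int j - int i))"
      "(real N + of_int (int j - int i)) / (w + real N + of_int (int j - int i))
        \<le> ratio_bound R W \<bar>of_int (int j - int i)\<bar>" if "(i, j) \<in> \<nu>" for i j
    proof -
      show "(real N + of_int (int j - int i)) / (w + real N + of_int (int j - int i))
        \<le> ratio_bound R W \<bar>of_int (int j - int i)\<bar>"
        by (rule ratio_bound_ge[OF pos w pos'[OF that]])
      have "0 < w"
        using pos w by linarith
      then show "0 \<le> (real N + of_int (int j - int i)) / (w + real N + of_int (int j - int i))"
        using pos'[OF that] by (intro divide_nonneg_nonneg) linarith+
    qed
    then show ?thesis
      unfolding ratio content_product_def by (auto intro!: prod_nonneg prod_mono)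
  qed
  then show "0 \<le> content_ratio N w \<nu>"
    "content_ratio N w \<nu> \<le> content_product (\<lambda>c. ratio_bound R W \<bar>of_int c\<bar>) \<nu>"
    by auto
qed

text \<open>
  Each factor of the Pochhammer products is at most \<open>A + \<bar>c\<bar>\<close> in absolute value, and the dimension
  is controlled by \<open>dim_diagram_content_bound\<close>.
\<close>

lemma diagram_weight_le:
  assumes \<nu>: "\<nu> \<in> young_diagrams" and A: "norm z \<le> A" "norm z' \<le> A"
  shows "diagram_weight z z' \<nu> \<le>
    content_product (\<lambda>c. ((A + \<bar>of_int c\<bar>) / max 1 \<bar>of_int c\<bar>)\<^sup>2) \<nu>"
proof -
  let ?P = "content_product (\<lambda>c. A + \<bar>real_of_int c\<bar>) \<nu>"
  let ?M = "content_product (\<lambda>c. max 1 \<bar>real_of_int c\<bar>) \<nu>"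
  have P: "norm (diagram_pochhammer u \<nu>) \<le> ?P" if u: "norm u \<le> A" for u
    unfolding diagram_pochhammer_def content_product_def prod_norm[symmetric]
  proof (rule prod_mono, clarify)
    fix i j
    have "u + of_nat j - of_nat i = u + of_int (int j - int i)" by simp
    also have "norm \<dots> \<le> norm u + norm (of_int (int j - int i) :: complex)"
      by (rule norm_triangle_ineq)
    also have "\<dots> \<le> A + \<bar>real_of_int (int j - int i)\<bar>"
      using u by (simp only: norm_of_int add_mono order_refl)
    finally show "0 \<le> norm (u + of_nat j - of_nat i) \<and>
        norm (u + of_nat j - of_nat i) \<le> A + \<bar>real_of_int (int j - int i)\<bar>" by simp
  qed
  have M: "0 < ?M"
    unfolding content_product_def by (intro prod_pos) auto
  have "Re (diagram_pochhammer z \<nu> * diagram_pochhammer z' \<nu>) \<le>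
      norm (diagram_pochhammer z \<nu>) * norm (diagram_pochhammer z' \<nu>)"
    using complex_Re_le_cmod norm_mult by metis
  also have "\<dots> \<le> ?P * ?P"
    using P A order_trans[OF norm_ge_zero P[OF A(1)]] by (intro mult_mono) auto
  finally have "diagram_weight z z' \<nu> \<le> ?P * ?P * (real (dim_diagram \<nu>) / fact (card \<nu>))\<^sup>2"
    unfolding diagram_weight_def by (rule mult_right_mono) simp
  also have "real (dim_diagram \<nu>) / fact (card \<nu>) \<le> 1 / ?M"
    using dim_diagram_content_bound[OF \<nu>] M by (simp add: field_simps)
  then have "?P * ?P * (real (dim_diagram \<nu>) / fact (card \<nu>))\<^sup>2 \<le> ?P * ?P * (1 / ?M)\<^sup>2"
    by (intro mult_left_mono power_mono) auto
  also have "\<dots> = content_product (\<lambda>c. ((A + \<bar>of_int c\<bar>) / max 1 \<bar>of_int c\<bar>)\<^sup>2) \<nu>"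
    unfolding content_product_def power2_eq_square
    by (simp add: prod_dividef prod.distrib split_def)
  finally show ?thesis .
qed

text \<open>
  The contribution of a box of content \<open>\<plusminus> a\<close> to the dominating function: the square bounds its share
  of \<open>diagram_weight\<close>, the other factor its share of the content ratio.
\<close>

definition dominating_factor :: "real \<Rightarrow> real \<Rightarrow> real \<Rightarrow> real \<Rightarrow> real" where
  "dominating_factor A R W a = ((A + a) / max 1 a)\<^sup>2 * ratio_bound R W a"

text \<open>
  The factor at \<open>c\<close> is \<open>1 + (2 * A - W) / c\<close> up to smaller terms, so the product decays like the
  power \<open>2 * A - W\<close> of \<open>n\<close>. The choice \<open>W = 2 * A + 2\<close> makes the exponent \<open>-2\<close>, and Raabe's test applies.
\<close>

lemma summable_prod_dominating_factor:
  assumes "A > 0" "R > 0"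
  shows "summable (\<lambda>n. \<Prod>c = 1..n. dominating_factor A R (2 * A + 2) (real c))"
proof -
  define W where "W = 2 * A + 2"
  define f where "f = (\<lambda>n. \<Prod>c = 1..n. dominating_factor A R W (real c))"
  have pos: "0 < dominating_factor A R W (real c)" if "c \<ge> 1" for c
    using assms that unfolding dominating_factor_def ratio_bound_def W_def
    by (intro mult_pos_pos divide_pos_pos zero_less_power add_pos_nonneg) auto
  have f_pos: "0 < f n" for n
    unfolding f_def by (intro prod_pos) (auto intro: pos)
  have quotient: "f n / f (Suc n) =
      ((real n + 1) / (A + (real n + 1)))\<^sup>2 * (((R + 1) * W + (real n + 1)) / (R * W + (real n + 1)))" for n
  proof -
    have "f n / f (Suc n) = 1 / dominating_factor A R W (real (Suc n))"
    proof -
      have "f (Suc n) = f n * dominating_factor A R W (real (Suc n))"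
        by (simp add: f_def)
      then show ?thesis
        using f_pos[of n] by simp
    qed
    then show ?thesis
      by (simp add: dominating_factor_def ratio_bound_def power_divide add.commute max_def)
  qed
  have "(\<lambda>n. real n * (((real n + 1) / (A + (real n + 1)))\<^sup>2 *
      (((R + 1) * W + (real n + 1)) / (R * W + (real n + 1))) - 1))
      \<longlonglongrightarrow> (R + 1) * (2 * A + 2) - R * (2 * A + 2) - A * 2"
    unfolding W_def using assms by real_asymp
  moreover have "(R + 1) * (2 * A + 2) - R * (2 * A + 2) - A * 2 = 2"
    by (simp add: algebra_simps)
  ultimately have "(\<lambda>n. real n * (((real n + 1) / (A + (real n + 1)))\<^sup>2 *
      (((R + 1) * W + (real n + 1)) / (R * W + (real n + 1))) - 1)) \<longlonglongrightarrow> 2"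
    by simp
  then have "(\<lambda>n. ereal (real n * (f n / f (Suc n) - 1))) \<longlonglongrightarrow> ereal 2"
    unfolding quotient by (rule tendsto_ereal)
  then have "liminf (\<lambda>n. ereal (real n * (f n / f (Suc n) - 1))) = ereal 2"
    by (rule lim_imp_Liminf[OF sequentially_bot])
  then have "summable f"
    using f_pos by (intro raabes_test_convergence) auto
  then show ?thesis
    by (simp add: f_def W_def)
qed

lemma dominating_content_product_summable:
  assumes "A > 0" "R > 0"
  shows "content_product (\<lambda>c. dominating_factor A R (2 * A + 2) \<bar>of_int c\<bar>) summable_on young_diagrams"
proof (rule content_product_summable)
  let ?f = "\<lambda>c. dominating_factor A R (2 * A + 2) \<bar>real_of_int c\<bar>"
  show "0 \<le> ?f c" for c
    unfolding dominating_factor_def using assms by (intro mult_nonneg_nonneg ratio_bound_nonneg) auto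
  show "summable (\<lambda>y. \<Prod>c = 1..y. ?f (- int c))"
    using summable_prod_dominating_factor[OF assms] by simp
  have "(\<Prod>c = 0..x. ?f (int c)) = ?f 0 * (\<Prod>c = 1..x. dominating_factor A R (2 * A + 2) (real c))" for x
    by (simp add: prod.atLeast_Suc_atMost)
  then show "summable (\<lambda>x. \<Prod>c = 0..x. ?f (int c))"
    using summable_mult[OF summable_prod_dominating_factor[OF assms]] by simp
qed

lemma content_ratio_tendsto:
  assumes w: "filterlim w at_top F" and N: "((\<lambda>t. real (N t) / w t) \<longlongrightarrow> r) F" and r: "r > 0"
  shows "((\<lambda>t. content_ratio (N t) (w t) \<nu>) \<longlongrightarrow> (r / (1 + r)) ^ card \<nu>) F"
proof -
  have w0: "((\<lambda>t. 1 / w t) \<longlongrightarrow> 0) F"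
    using tendsto_inverse_0_at_top[OF w] by (simp add: divide_inverse)
  have pos: "\<forall>\<^sub>F t in F. 0 < w t"
    using w by (simp add: filterlim_at_top_dense)
  have factor: "((\<lambda>t. (real (N t) + c) / (w t + real (N t) + c)) \<longlongrightarrow> r / (1 + r)) F" for c
  proof (rule Lim_transform_eventually)
    have "((\<lambda>t. (real (N t) / w t + c * (1 / w t)) / (1 + real (N t) / w t + c * (1 / w t)))
        \<longlongrightarrow> (r + c * 0) / (1 + r + c * 0)) F"
      using r by (intro tendsto_intros N w0) auto
    then show "((\<lambda>t. (real (N t) / w t + c * (1 / w t)) / (1 + real (N t) / w t + c * (1 / w t)))
        \<longlongrightarrow> r / (1 + r)) F"
      by simp
    show "\<forall>\<^sub>F t in F. (real (N t) / w t + c * (1 / w t)) / (1 + real (N t) / w t + c * (1 / w t)) =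
        (real (N t) + c) / (w t + real (N t) + c)"
      using pos
    proof eventually_elim
      case (elim t)
      have "real (N t) / w t + c * (1 / w t) = (real (N t) + c) / w t"
        "1 + real (N t) / w t + c * (1 / w t) = (w t + real (N t) + c) / w t"
        using elim by (simp_all add: field_simps)
      then show ?case
        using elim by simp
    qed
  qed
  have "((\<lambda>t. \<Prod>b\<in>\<nu>. (real (N t) + of_int (int (snd b) - int (fst b))) /
      (w t + real (N t) + of_int (int (snd b) - int (fst b)))) \<longlongrightarrow> (\<Prod>b\<in>\<nu>. r / (1 + r))) F"
    by (intro tendsto_prod factor)
  then show ?thesis
    unfolding content_ratio_def content_product_def prod_dividef[symmetric] by (simp add: split_def)
qed

section \<open>Convergence to the z-measure\<close>

theorem theorem4p7p1:
  fixes z z' :: complex and r :: real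
    and F :: "'i filter" and w' :: "'i \<Rightarrow> real" and N :: "'i \<Rightarrow> nat"
  assumes "admissible z z'"
    and "r > 0"
    and "\<And>t. w' t > 0"
    and "\<And>t. N t > 0"
    and "filterlim w' at_top F"
    and "(\<lambda>t. real (N t)) \<sim>[F] (\<lambda>t. r * w' t)"
  shows "weak_convergence (discrete_topology young_diagrams)
           (\<lambda>t. zw_measure_young z z' (w' t) (N t)) (z_measure (- z) (- z') r) F"
proof -
  note adm = assms(1) and r = assms(2)
  note adm' = admissible_uminus[OF adm]
  define p where "p = diagram_weight (- z) (- z')"
  define k where "k = (\<lambda>t. Re (zw_prefactor z z' (w' t) (N t)))"
  define k0 where "k0 = (1 + r) powr (- Re (z * z'))"
  define A where "A = norm z + norm z'"
  \<comment> \<open>Since \<open>r < R\<close>, eventually \<open>N / w' < R\<close>.\<close>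
  define R where "R = 2 * r"
  define W where "W = 2 * A + 2"
  define g where "g = content_product (\<lambda>c. dominating_factor A R W \<bar>of_int c\<bar>)"
  \<comment> \<open>The masses of the zw-measures and of the z-measure. Eventually both are at most \<open>(k0 + 1) * g\<close>.\<close>
  define m where "m = (\<lambda>t \<nu>. k t * p \<nu> * content_ratio (N t) (w' t) \<nu>)"
  define m0 where "m0 = (\<lambda>\<nu>. k0 * p \<nu> * (r / (1 + r)) ^ card \<nu>)"
  have A: "A > 0"
    using adm by (auto simp: A_def admissible_def intro: add_pos_nonneg)
  have pos: "R > 0" "W > 0" "W \<ge> A"
    using r A by (simp_all add: R_def W_def)
  have N_lim: "((\<lambda>t. real (N t) / w' t) \<longlongrightarrow> r) F"
  proof -
    have "((\<lambda>t. real (N t) / (r * w' t)) \<longlongrightarrow> 1) F"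
      using asymp_equivD[OF assms(6)] assms(2,3) by (simp add: less_imp_neq[symmetric])
    then have "((\<lambda>t. r * (real (N t) / (r * w' t))) \<longlongrightarrow> r * 1) F"
      by (intro tendsto_intros)
    then show ?thesis
      using r by simp
  qed
  have k_lim: "(k \<longlongrightarrow> k0) F"
  proof -
    have "of_real (1 + r) powr (- (z * z')) = complex_of_real k0"
    proof -
      have "z * z' = of_real (Re (z * z'))"
        by (rule of_real_Re[OF admissible_cases(1)[OF adm], symmetric])
      then show ?thesis
        using powr_of_real[of "1 + r" "- Re (z * z')"] r by (simp only: k0_def) simp
    qed
    then show ?thesis
      using tendsto_Re[OF zw_prefactor_tendsto[OF adm r assms(5) N_lim]] by (simp add: k_def)
  qed
  have k0: "0 \<le> k0" by (simp add: k0_def)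
  have p: "0 \<le> p \<nu>" if "\<nu> \<in> young_diagrams" for \<nu>
    unfolding p_def by (rule diagram_weight_nonneg[OF adm' that])
  have g: "g summable_on young_diagrams"
    unfolding g_def W_def by (rule dominating_content_product_summable[OF A pos(1)])
  have p_le: "p \<nu> * x \<le> g \<nu>"
    if \<nu>: "\<nu> \<in> young_diagrams" and x: "0 \<le> x" "x \<le> content_product (\<lambda>c. ratio_bound R W \<bar>of_int c\<bar>) \<nu>" for \<nu> x
  proof -
    have "p \<nu> \<le> content_product (\<lambda>c. ((A + \<bar>of_int c\<bar>) / max 1 \<bar>of_int c\<bar>)\<^sup>2) \<nu>"
      unfolding p_def by (rule diagram_weight_le[OF \<nu>]) (simp_all add: A_def)
    then have "p \<nu> * x \<le> content_product (\<lambda>c. ((A + \<bar>of_int c\<bar>) / max 1 \<bar>of_int c\<bar>)\<^sup>2) \<nu> *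
        content_product (\<lambda>c. ratio_bound R W \<bar>of_int c\<bar>) \<nu>"
      using x p[OF \<nu>] by (intro mult_mono) auto
    also have "\<dots> = g \<nu>"
      unfolding g_def content_product_def dominating_factor_def by (simp add: prod.distrib[symmetric] split_def)
    finally show ?thesis .
  qed
  have m0: "0 \<le> m0 \<nu>" "m0 \<nu> \<le> (k0 + 1) * g \<nu>" if \<nu>: "\<nu> \<in> young_diagrams" for \<nu>
  proof -
    show "0 \<le> m0 \<nu>"
      unfolding m0_def using k0 p[OF \<nu>] r by simp
    have "p \<nu> * (r / (1 + r)) ^ card \<nu> \<le> g \<nu>"
      using r pos by (intro p_le[OF \<nu>] power_le_ratio_bound) (auto simp: R_def)
    moreover have "0 \<le> p \<nu> * (r / (1 + r)) ^ card \<nu>"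
      using p[OF \<nu>] r by simp
    ultimately have "k0 * (p \<nu> * (r / (1 + r)) ^ card \<nu>) \<le> (k0 + 1) * g \<nu>"
      using k0 by (intro mult_mono) auto
    then show "m0 \<nu> \<le> (k0 + 1) * g \<nu>"
      by (simp add: m0_def mult.assoc)
  qed
  have regime: "\<forall>\<^sub>F t in F. W \<le> w' t \<and> real (N t) \<le> R * w' t \<and> k t \<le> k0 + 1"
  proof -
    have "\<forall>\<^sub>F t in F. W \<le> w' t"
      using assms(5) by (simp add: filterlim_at_top)
    moreover have "\<forall>\<^sub>F t in F. real (N t) / w' t < R"
      using r by (intro order_tendstoD(2)[OF N_lim]) (simp add: R_def)
    moreover have "\<forall>\<^sub>F t in F. k t < k0 + 1"
      by (rule order_tendstoD(2)[OF k_lim]) simp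
    ultimately show ?thesis
    proof eventually_elim
      case (elim t)
      then show ?case
        using assms(3)[of t] by (simp add: field_simps)
    qed
  qed
  have m: "0 \<le> m t \<nu>" "m t \<nu> \<le> (k0 + 1) * g \<nu>"
    if t: "W \<le> w' t \<and> real (N t) \<le> R * w' t \<and> k t \<le> k0 + 1" and \<nu>: "\<nu> \<in> young_diagrams" for t \<nu>
  proof -
    have "norm z + norm z' \<le> w' t"
      using t pos(3) by (simp add: A_def)
    then have k: "0 \<le> k t"
      using zw_prefactor_nonneg[OF adm] unfolding k_def by (simp add: complex_nonneg_Reals_iff)
    note c = content_ratio_bounds[OF \<nu> pos(1,2), of "w' t" "N t"]
    show "0 \<le> m t \<nu>"
      unfolding m_def using k p[OF \<nu>] c(1) t by simp
    have "p \<nu> * content_ratio (N t) (w' t) \<nu> \<le> g \<nu>"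
      using c t by (intro p_le[OF \<nu>]) auto
    moreover have "0 \<le> p \<nu> * content_ratio (N t) (w' t) \<nu>"
      using p[OF \<nu>] c(1) t by simp
    ultimately have "k t * (p \<nu> * content_ratio (N t) (w' t) \<nu>) \<le> (k0 + 1) * g \<nu>"
      using t k0 k by (intro mult_mono) auto
    then show "m t \<nu> \<le> (k0 + 1) * g \<nu>"
      by (simp add: m_def mult.assoc)
  qed
  have g': "(\<lambda>\<nu>. (k0 + 1) * g \<nu>) summable_on young_diagrams"
    by (rule summable_on_cmult_right[OF g])
  have m_lim: "((\<lambda>t. m t \<nu>) \<longlongrightarrow> m0 \<nu>) F" for \<nu>
    unfolding m_def m0_def by (intro tendsto_intros k_lim content_ratio_tendsto[OF assms(5) N_lim r])
  have zw_eq: "zw_measure_young z z' (w' t) (N t) =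
      density (count_space young_diagrams) (\<lambda>\<nu>. ennreal (m t \<nu>))" if "W \<le> w' t" for t
    unfolding m_def k_def p_def
    using that pos(3) assms(4)[of t] by (intro zw_measure_young_eq_density[OF adm]) (auto simp: A_def)
  have z_eq: "z_measure (- z) (- z') r =
      density (count_space young_diagrams) (\<lambda>\<nu>. ennreal (m0 \<nu>))"
    using z_measure_eq_density[OF adm' r] by (simp add: m0_def k0_def p_def)
  have m0_sum: "m0 summable_on young_diagrams"
    by (rule summable_on_comparison_test[OF g']) (use m0 in auto)
  have m_sum: "m t summable_on young_diagrams"
    if "W \<le> w' t \<and> real (N t) \<le> R * w' t \<and> k t \<le> k0 + 1" for t
    by (rule summable_on_comparison_test[OF g']) (use m[OF that] in auto)
  have "\<forall>\<^sub>F t in F. finite_measure (zw_measure_young z z' (w' t) (N t))"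
    using regime
  proof eventually_elim
    case (elim t)
    then show ?case
      using zw_eq[of t] finite_measure_density_count_space[OF m_sum[OF elim] m(1)[OF elim]] by simp
  qed
  moreover have "finite_measure (z_measure (- z) (- z') r)"
    unfolding z_eq by (rule finite_measure_density_count_space[OF m0_sum m0(1)])
  moreover have "((\<lambda>t. integral\<^sup>L (zw_measure_young z z' (w' t) (N t)) f)
      \<longlongrightarrow> integral\<^sup>L (z_measure (- z) (- z') r) f) F"
    if bounded: "bounded (f ` young_diagrams)" for f :: "(nat \<times> nat) set \<Rightarrow> real"
  proof -
    obtain b where b: "\<And>\<nu>. \<nu> \<in> young_diagrams \<Longrightarrow> \<bar>f \<nu>\<bar> \<le> b"
      using bounded unfolding bounded_iff by auto
    have dom: "\<bar>u * f \<nu>\<bar> \<le> (k0 + 1) * g \<nu> * b"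
      if "\<nu> \<in> young_diagrams" "0 \<le> u" "u \<le> (k0 + 1) * g \<nu>" for u \<nu>
      using that b[OF that(1)] unfolding abs_mult by (intro mult_mono) auto
    have "((\<lambda>t. \<Sum>\<^sub>\<infinity>\<nu>\<in>young_diagrams. m t \<nu> * f \<nu>) \<longlongrightarrow> (\<Sum>\<^sub>\<infinity>\<nu>\<in>young_diagrams. m0 \<nu> * f \<nu>)) F"
    proof (rule tannery_summable_on)
      show "(\<lambda>\<nu>. (k0 + 1) * g \<nu> * b) summable_on young_diagrams"
        by (rule summable_on_cmult_left[OF g'])
      show "\<forall>\<^sub>F t in F. \<forall>\<nu>\<in>young_diagrams. \<bar>m t \<nu> * f \<nu>\<bar> \<le> (k0 + 1) * g \<nu> * b"
        using regime by eventually_elim (intro ballI dom m)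
      show "\<bar>m0 \<nu> * f \<nu>\<bar> \<le> (k0 + 1) * g \<nu> * b" if "\<nu> \<in> young_diagrams" for \<nu>
        by (intro dom m0 that)
      show "((\<lambda>t. m t \<nu> * f \<nu>) \<longlongrightarrow> m0 \<nu> * f \<nu>) F" for \<nu>
        by (intro tendsto_intros m_lim)
    qed
    moreover have "\<forall>\<^sub>F t in F. (\<Sum>\<^sub>\<infinity>\<nu>\<in>young_diagrams. m t \<nu> * f \<nu>) =
        integral\<^sup>L (zw_measure_young z z' (w' t) (N t)) f"
      using regime
    proof eventually_elim
      case (elim t)
      then show ?case
        using zw_eq[of t] integral_density_count_space[OF m_sum[OF elim] m(1)[OF elim] b] by simp
    qed
    moreover have "integral\<^sup>L (z_measure (- z) (- z') r) f = (\<Sum>\<^sub>\<infinity>\<nu>\<in>young_diagrams. m0 \<nu> * f \<nu>)"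
      unfolding z_eq by (rule integral_density_count_space[OF m0_sum m0(1) b])
    ultimately show ?thesis
      using Lim_transform_eventually by fastforce
  qed
  ultimately show ?thesis
    unfolding weak_convergence_def by simp
qed

end
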